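(* Let $\rho>0$, $\sigma^2>0$, let $\mathbf g\in\mathbb C^{M_R}$, $\mathbf h\in\mathbb C^{M_T}$ have unit-modulus entries, $\mathbf H=\mathbf g\mathbf h^T$, let $\mathbf\Phi\in\mathbb R^{M_R\times M_T}$ with $\mathrm{vec}(\mathbf\Phi)\sim\mathcal N(\mathbf 0,\sigma^2\mathbf I_{M_TM_R})$, $\hat{\mathbf H}=\mathbf H\circ(\mathbf 1+j\mathbf\Phi)$ and $\hat C=\mathbb E\{\log_2\det(\mathbf I_{M_R}+\frac{\rho}{M_T}\hat{\mathbf H}\hat{\mathbf H}^H)\}$. If $M_R\le M_T$ then $$\hat C\ge\log_2\Big(1+\sum_{n=1}^{M_R}\Big(\frac{\rho}{M_T}\Big)^n\binom{M_R}{n}\prod_{i=0}^{n-1}\Big(\delta_i\,nM_T+2\sigma^2e^{\psi\left(\frac{M_T-i}{2}\right)}\Big)\Big),$$ and if $M_R>M_T$ then $$\hat C\ge\log_2\Big(1+\sum_{n=1}^{M_T}\Big(\frac{\rho}{M_T}\Big)^n\binom{M_T}{n}\prod_{i=0}^{n-1}\Big(\delta_i\,nM_R+2\sigma^2e^{\psi\left(\frac{M_R-i}{2}\right)}\Big)\Big).$$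
   Context: $\circ$ is the Hadamard product, $\mathbf 1$ the all-ones matrix, $\delta_i=1$ if $i=0$ and $0$ otherwise, $\psi(z)=\Gamma'(z)/\Gamma(z)$ is the digamma function. *)

theory Defs
  imports "HOL-Probability.Probability" "Jordan_Normal_Form.Determinant"
begin

definition herm :: "complex mat \<Rightarrow> complex mat" where
  "herm A = mat (dim_col A) (dim_row A) (\<lambda>(i,j). cnj (A $$ (j,i)))"

definition Hhat :: "nat \<Rightarrow> nat \<Rightarrow> (nat \<Rightarrow> complex) \<Rightarrow> (nat \<Rightarrow> complex)
                      \<Rightarrow> (nat \<times> nat \<Rightarrow> real) \<Rightarrow> complex mat" where
  "Hhat MR MT g h Phi = mat MR MT (\<lambda>(i,j). (g i * h j) * (1 + \<i> * complex_of_real (Phi (i,j))))"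

definition Phi_dist :: "nat \<Rightarrow> nat \<Rightarrow> real \<Rightarrow> (nat \<times> nat \<Rightarrow> real) measure" where
  "Phi_dist MR MT s2 = PiM ({..<MR} \<times> {..<MT}) (\<lambda>_. density lborel (normal_density 0 (sqrt s2)))"

(* log2 det(I + rho/MT * H H^H)  (the determinant is real and >= 1) *)
definition cap_integrand :: "nat \<Rightarrow> nat \<Rightarrow> real \<Rightarrow> complex mat \<Rightarrow> real" where
  "cap_integrand MR MT rho H =
     log 2 (Re (det (1\<^sub>m MR + complex_of_real (rho / real MT) \<cdot>\<^sub>m (H * herm H))))"

definition Chat :: "nat \<Rightarrow> nat \<Rightarrow> real \<Rightarrow> real \<Rightarrow> (nat \<Rightarrow> complex) \<Rightarrow> (nat \<Rightarrow> complex) \<Rightarrow> ennreal" where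
  "Chat MR MT rho s2 g h =
     (\<integral>\<^sup>+ Phi. ennreal (cap_integrand MR MT rho (Hhat MR MT g h Phi)) \<partial>Phi_dist MR MT s2)"

end

theory Submission
  imports Defs
begin

text \<open>The unit-modulus factors drop out of all principal minors, and the capacity determinant is
  \<open>1 + \<Sum>\<^sub>S (\<rho>/M\<^sub>T)\<^bsup>|S|\<^esup> D\<^sub>S\<close>, where \<open>D\<^sub>S\<close> is the Gram determinant of the rows in \<open>S\<close> of
  \<open>\<Phi> - \<i> 1 1\<^sup>T\<close>. A rotation of these \<open>n\<close> rows concentrates the imaginary part in one of them, and then
  \<open>D\<^sub>S\<close> is the Gram determinant of an \<open>n \<times> M\<close> Gaussian matrix plus \<open>n\<close> times the one in which one row
  is replaced by \<open>1\<close>. Rotating columns peels off one row at a time and turns both into products of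
  independent squared norms of Gaussian vectors.
  The geometric mean is superadditive, so it suffices to bound that of each summand from below.
  This is done through negative moments: \<open>E ln X \<ge> - ln E X\<^bsup>-t\<^esup> / t\<close>, and for \<open>X = |\<phi>|\<^sup>2\<close> in dimension
  \<open>k\<close> one has \<open>E X\<^bsup>-t\<^esup> = (2\<sigma>\<^sup>2)\<^bsup>-t\<^esup> \<Gamma>(k/2 - t) / \<Gamma>(k/2)\<close>; the digamma function appears as \<open>t\<close> tends to
  \<open>0\<close>. If \<open>M\<^sub>R > M\<^sub>T\<close>, Sylvester's identity exchanges the two dimensions.\<close>

subsection \<open>Negative moments of Gaussian vectors\<close>

text \<open>With the value \<open>\<infinity>\<close> off the positive reals, a finite negative moment entails almost sure
  positivity.\<close>

definition npow :: "real \<Rightarrow> real \<Rightarrow> ennreal" where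
  "npow t x = (if x > 0 then ennreal (x powr - t) else Orderings.top)"

lemma npow_measurable [measurable]: "npow t \<in> borel_measurable borel"
  unfolding npow_def[abs_def] by measurable

text \<open>Multiplicativity survives the value \<open>top\<close> because \<open>npow\<close> never
  vanishes, so no product of 0 and \<open>top\<close> arises.\<close>

lemma npow_mult: "a \<ge> 0 \<Longrightarrow> npow t (a * x) = npow t a * npow t x"
  by (cases "a = 0"; cases "x > 0")
    (auto simp: npow_def ennreal_top_mult ennreal_mult_top zero_less_mult_iff powr_mult
      ennreal_mult' ennreal_eq_0_iff mult.commute)

text \<open>Substitution of \<open>x * s\<close> for the variable in Euler's integral for
  \<open>Gamma t\<close>.\<close>

lemma nn_integral_powr_exp:
  fixes t x :: real
  assumes "t > 0" "x > 0"
  shows "(\<integral>\<^sup>+s. ennreal (indicator {0..} s * s powr (t - 1) * exp (- (x * s))) \<partial>lborel)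
       = ennreal (Gamma t * x powr - t)"
proof -
  have "ennreal (Gamma t) =
    (\<integral>\<^sup>+s. ennreal (indicator {0..} s * s powr (t - 1) / exp s) \<partial>lborel)"
    using Gamma_conv_nn_integral_real[OF assms(1)] .
  also have "\<dots> = \<bar>x\<bar> * (\<integral>\<^sup>+s. ennreal (indicator {0..} (0 + x * s) * (0 + x * s) powr (t - 1) / exp (0 + x * s)) \<partial>lborel)"
    using assms by (intro nn_integral_real_affine) auto
  also have "(\<integral>\<^sup>+s. ennreal (indicator {0..} (0 + x * s) * (0 + x * s) powr (t - 1) / exp (0 + x * s)) \<partial>lborel)
    = (\<integral>\<^sup>+s. ennreal (x powr (t - 1)) * ennreal (indicator {0..} s * s powr (t - 1) * exp (- (x * s))) \<partial>lborel)"
    using assms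
    by (intro nn_integral_cong)
      (auto simp: indicator_def zero_le_mult_iff powr_mult exp_minus field_simps ennreal_mult'[symmetric])
  also have "\<dots> = ennreal (x powr (t - 1)) * (\<integral>\<^sup>+s. ennreal (indicator {0..} s * s powr (t - 1) * exp (- (x * s))) \<partial>lborel)"
    by (intro nn_integral_cmult) measurable
  finally have *: "ennreal (Gamma t) = ennreal (x powr t) *
     (\<integral>\<^sup>+s. ennreal (indicator {0..} s * s powr (t - 1) * exp (- (x * s))) \<partial>lborel)"
    using assms by (simp add: mult.assoc[symmetric] ennreal_mult'[symmetric] powr_mult_base)
  have "ennreal (x powr - t) * ennreal (Gamma t) = ennreal (x powr - t * x powr t) *
     (\<integral>\<^sup>+s. ennreal (indicator {0..} s * s powr (t - 1) * exp (- (x * s))) \<partial>lborel)"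
    unfolding * by (simp add: ennreal_mult' mult.assoc)
  also have "x powr - t * x powr t = 1"
    using assms by (simp flip: powr_add)
  finally have "ennreal (x powr - t) * ennreal (Gamma t) =
     (\<integral>\<^sup>+s. ennreal (indicator {0..} s * s powr (t - 1) * exp (- (x * s))) \<partial>lborel)"
    by simp
  moreover have "ennreal (x powr - t) * ennreal (Gamma t) = ennreal (Gamma t * x powr - t)"
    by (subst ennreal_mult'[symmetric]) (auto simp: mult.commute)
  ultimately show ?thesis by simp
qed

text \<open>The case \<open>x = 0\<close> is where the convention \<open>npow t 0 = top\<close>
  matters: the integral then dominates \<open>Gamma t * y powr - t\<close> for every
  \<open>y > 0\<close>, and this is unbounded as \<open>y\<close> tends to 0.\<close>

lemma nn_integral_powr_exp_npow:
  fixes t x :: real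
  assumes "t > 0" "x \<ge> 0"
  shows "(\<integral>\<^sup>+s. ennreal (indicator {0..} s * s powr (t - 1) * exp (- (x * s))) \<partial>lborel)
       = ennreal (Gamma t) * npow t x"
proof (cases "x = 0")
  case True
  have G: "Gamma t > 0" using assms by simp
  let ?I = "\<integral>\<^sup>+s. ennreal (indicator {0..} s * s powr (t - 1) * exp (- (x * s))) \<partial>lborel"
  have ge: "ennreal (Gamma t * y powr - t) \<le> ?I" if "y > 0" for y :: real
    unfolding nn_integral_powr_exp[OF assms(1) that, symmetric]
    using that True by (intro nn_integral_mono) (auto simp: indicator_def intro!: ennreal_leI mult_left_le)
  have "?I = Orderings.top"
  proof (rule ccontr)
    assume "?I \<noteq> Orderings.top"
    then obtain r where r: "?I = ennreal r" "r \<ge> 0" by (cases ?I) auto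
    \<comment> \<open>Chosen so that \<open>Gamma t * y powr - t = r + 1\<close>, which exceeds the
      supposed value \<open>r\<close> of the integral.\<close>
    define y where "y = ((r + 1) / Gamma t) powr (- 1 / t)"
    have "y > 0" using r G by (simp add: y_def)
    from ge[OF this] have "Gamma t * y powr - t \<le> r" using r by (simp add: ennreal_le_iff)
    moreover have "y powr - t = (r + 1) / Gamma t"
      using r G assms by (simp add: y_def powr_powr)
    ultimately show False using G by simp
  qed
  with True G show ?thesis by (simp add: npow_def ennreal_mult_top)
next
  case False
  with assms show ?thesis
    by (subst nn_integral_powr_exp) (auto simp: npow_def ennreal_mult' Gamma_real_pos)
qed

section \<open>Gaussian product measures and the moments of their squared norms\<close>

abbreviation gauss :: "real \<Rightarrow> real measure" where
  "gauss s2 \<equiv> density lborel (normal_density 0 (sqrt s2))"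

lemma nn_integral_normal_density:
  "\<sigma> > 0 \<Longrightarrow> (\<integral>\<^sup>+x. ennreal (normal_density 0 \<sigma> x) \<partial>lborel) = 1"
  by (simp add: nn_integral_eq_integral)

text \<open>Tilting by \<open>exp (- (x\<^sup>2 * s))\<close> turns the normal density of variance
  \<open>s2\<close> into \<open>q powr (-1/2)\<close> times the one of variance
  \<open>s2 / q\<close>, where \<open>q = 1 + 2 * s2 * s\<close>; the latter has mass 1.\<close>

lemma nn_integral_gauss_laplace:
  fixes s2 s :: real
  assumes "s2 > 0" "s \<ge> 0"
  shows "(\<integral>\<^sup>+x. ennreal (exp (- (x\<^sup>2 * s))) \<partial>gauss s2) = ennreal ((1 + 2 * s2 * s) powr (-1/2))"
proof -
  define q where "q = 1 + 2 * s2 * s"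
  have q: "q > 0" using assms by (auto simp: q_def intro: add_pos_nonneg)
  have *: "normal_density 0 (sqrt s2) x * exp (- (x\<^sup>2 * s)) = q powr (-1/2) * normal_density 0 (sqrt (s2 / q)) x" for x
  proof -
    have A: "normal_density 0 (sqrt s2) x = 1 / sqrt (2 * pi * s2) * exp (- x\<^sup>2 / (2 * s2))"
      using assms by (simp add: normal_density_def)
    have B: "normal_density 0 (sqrt (s2 / q)) x = 1 / sqrt (2 * pi * (s2 / q)) * exp (- x\<^sup>2 / (2 * (s2 / q)))"
      using assms q by (simp add: normal_density_def)
    have C: "- x\<^sup>2 / (2 * s2) + - (x\<^sup>2 * s) = - x\<^sup>2 / (2 * (s2 / q))"
      using assms q by (simp add: q_def field_simps)
    have D: "1 / sqrt (2 * pi * s2) = q powr (-1/2) * (1 / sqrt (2 * pi * (s2 / q)))"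
      using assms q by (simp add: powr_minus_divide powr_half_sqrt real_sqrt_mult real_sqrt_divide)
    have "normal_density 0 (sqrt s2) x * exp (- (x\<^sup>2 * s))
        = 1 / sqrt (2 * pi * s2) * exp (- x\<^sup>2 / (2 * (s2 / q)))"
      unfolding A mult.assoc exp_add[symmetric] C ..
    then show ?thesis unfolding B D by (simp only: mult.assoc)
  qed
  have "(\<integral>\<^sup>+x. ennreal (exp (- (x\<^sup>2 * s))) \<partial>gauss s2) =
     (\<integral>\<^sup>+x. ennreal (q powr (-1/2)) * ennreal (normal_density 0 (sqrt (s2 / q)) x) \<partial>lborel)"
    by (subst nn_integral_density) (auto simp: ennreal_mult'[symmetric] * intro!: nn_integral_cong)
  also have "\<dots> = ennreal (q powr (-1/2))"
    using assms q by (subst nn_integral_cmult) (auto simp: nn_integral_normal_density)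
  finally show ?thesis by (simp add: q_def)
qed

lemma prob_space_gauss: "s2 > 0 \<Longrightarrow> prob_space (gauss s2)"
  by (intro prob_space_normal_density) simp

abbreviation gaussP :: "'i set \<Rightarrow> real \<Rightarrow> ('i \<Rightarrow> real) measure" where
  "gaussP I s2 \<equiv> PiM I (\<lambda>_. gauss s2)"

lemma prob_space_gaussP: "s2 > 0 \<Longrightarrow> prob_space (gaussP I s2)"
  by (intro prob_space_PiM prob_space_gauss)

lemma product_sigma_finite_gauss: "s2 > 0 \<Longrightarrow> product_sigma_finite (\<lambda>_. gauss s2)"
  by (simp add: product_sigma_finite_def prob_space_gauss prob_space_imp_sigma_finite)

lemma gauss_component [measurable (raw)]:
  "i \<in> I \<Longrightarrow> (\<lambda>\<phi>. \<phi> i) \<in> borel_measurable (gaussP I s2)"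
  using measurable_component_singleton[of i I "\<lambda>_. gauss s2"] by simp

text \<open>The moment of order \<open>- t\<close> of \<open>s2\<close> times a chi-squared variable
  with \<open>k\<close> degrees of freedom, finite for \<open>2 * t < k\<close>.\<close>

definition chi_nmom :: "real \<Rightarrow> real \<Rightarrow> nat \<Rightarrow> real" where
  "chi_nmom s2 t k = (2 * s2) powr - t * Gamma (real k / 2 - t) / Gamma (real k / 2)"

text \<open>Both \<open>x\<^bsup>-t\<^esup>\<close> and \<open>(1 + 2\<sigma>\<^sup>2 s)\<^bsup>-k/2\<^esup>\<close>, the Laplace transform of the squared norm, are written as Gamma
  integrals; Tonelli's theorem does the rest.\<close>

lemma nn_integral_npow_norm2:
  fixes s2 t :: real
  assumes s2: "s2 > 0" and t: "0 < t" "2 * t < card I" and fin: "finite I"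
  shows "(\<integral>\<^sup>+\<phi>. npow t (\<Sum>i\<in>I. (\<phi> i)\<^sup>2) \<partial>gaussP I s2) = ennreal (chi_nmom s2 t (card I))"
proof -
  interpret product_sigma_finite "\<lambda>_ :: 'a. gauss s2" by (rule product_sigma_finite_gauss[OF s2])
  interpret P: prob_space "gaussP I s2" by (rule prob_space_gaussP[OF s2])
  define a where "a = real (card I) / 2"
  have a: "a > t" "a > 0" using t by (auto simp: a_def)
  let ?w = "\<lambda>b s :: real. ennreal (indicator {0..} s * s powr (b - 1))"
  have G: "Gamma t > 0" "Gamma a > 0" "Gamma (a - t) > 0" using t a by (auto intro: Gamma_real_pos)
  interpret Q: pair_sigma_finite "gaussP I s2" lborel ..
  have laplace: "(\<integral>\<^sup>+\<phi>. ennreal (exp (- ((\<Sum>i\<in>I. (\<phi> i)\<^sup>2) * s))) \<partial>gaussP I s2) = ennreal ((1 + 2 * s2 * s) powr - a)"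
    if "s \<ge> 0" for s
  proof -
    have "(\<integral>\<^sup>+\<phi>. ennreal (exp (- ((\<Sum>i\<in>I. (\<phi> i)\<^sup>2) * s))) \<partial>gaussP I s2)
       = (\<integral>\<^sup>+\<phi>. (\<Prod>i\<in>I. ennreal (exp (- ((\<phi> i)\<^sup>2 * s)))) \<partial>gaussP I s2)"
      using fin by (intro nn_integral_cong) (simp add: prod_ennreal sum_distrib_right sum_negf flip: exp_sum)
    also have "\<dots> = (\<Prod>i\<in>I. \<integral>\<^sup>+x. ennreal (exp (- (x\<^sup>2 * s))) \<partial>gauss s2)"
      using fin by (intro product_nn_integral_prod) auto
    also have "\<dots> = ennreal (((1 + 2 * s2 * s) powr (-1/2)) ^ card I)"
      using that s2 by (simp add: nn_integral_gauss_laplace ennreal_power del: powr_minus)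
    also have "((1 + 2 * s2 * s) powr (-1/2)) ^ card I = (1 + 2 * s2 * s) powr - a"
      using add_pos_nonneg[of 1 "2 * s2 * s"] that s2
      by (subst powr_realpow[symmetric]) (auto simp: powr_powr a_def)
    finally show ?thesis .
  qed
  have m1: "(\<lambda>\<phi>. \<Sum>i\<in>I. (\<phi> i)\<^sup>2) \<in> borel_measurable (gaussP I s2)"
    by measurable
  have "ennreal (Gamma t) * (\<integral>\<^sup>+\<phi>. npow t (\<Sum>i\<in>I. (\<phi> i)\<^sup>2) \<partial>gaussP I s2)
      = (\<integral>\<^sup>+\<phi>. (\<integral>\<^sup>+s. ?w t s * ennreal (exp (- ((\<Sum>i\<in>I. (\<phi> i)\<^sup>2) * s))) \<partial>lborel) \<partial>gaussP I s2)"
    using t(1) m1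
    by (subst nn_integral_cmult[symmetric])
      (auto intro!: nn_integral_cong simp: sum_nonneg nn_integral_powr_exp_npow[symmetric] ennreal_mult'[symmetric])
  also have "\<dots> = (\<integral>\<^sup>+s. (\<integral>\<^sup>+\<phi>. ?w t s * ennreal (exp (- ((\<Sum>i\<in>I. (\<phi> i)\<^sup>2) * s))) \<partial>gaussP I s2) \<partial>lborel)"
    using m1 by (intro Q.Fubini'[symmetric]) measurable
  also have "\<dots> = (\<integral>\<^sup>+s. ?w t s * ennreal ((1 + 2 * s2 * s) powr - a) \<partial>lborel)"
    using m1 by (intro nn_integral_cong, subst nn_integral_cmult) (auto simp: laplace indicator_def)
  finally have 1: "ennreal (Gamma t) * (\<integral>\<^sup>+\<phi>. npow t (\<Sum>i\<in>I. (\<phi> i)\<^sup>2) \<partial>gaussP I s2)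
     = (\<integral>\<^sup>+s. ?w t s * ennreal ((1 + 2 * s2 * s) powr - a) \<partial>lborel)" .
  \<comment> \<open>Multiplying by \<open>Gamma a\<close> turns the power \<open>- a\<close> into an
    integral over \<open>r\<close>. After the exchange, the integral over \<open>s\<close> yields
    \<open>Gamma t * (2 * s2 * r) powr - t\<close>, and the remaining one over \<open>r\<close> is
    \<open>Gamma (a - t)\<close>, which converges since \<open>t < a\<close>.\<close>
  have "ennreal (Gamma a) * (\<integral>\<^sup>+s. ?w t s * ennreal ((1 + 2 * s2 * s) powr - a) \<partial>lborel)
     = (\<integral>\<^sup>+s. (\<integral>\<^sup>+r. ?w t s * (?w a r * ennreal (exp (- ((1 + 2 * s2 * s) * r)))) \<partial>lborel) \<partial>lborel)"
  proof (subst nn_integral_cmult[symmetric], measurable, intro nn_integral_cong)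
    fix s :: real
    show "ennreal (Gamma a) * (?w t s * ennreal ((1 + 2 * s2 * s) powr - a)) =
      (\<integral>\<^sup>+r. ?w t s * (?w a r * ennreal (exp (- ((1 + 2 * s2 * s) * r)))) \<partial>lborel)"
    proof (cases "s \<ge> 0")
      case True
      then have "1 + 2 * s2 * s > 0" using s2 by (auto intro: add_pos_nonneg)
      from nn_integral_powr_exp[OF a(2) this] show ?thesis using G
        by (subst nn_integral_cmult) (auto simp: ennreal_mult'[symmetric] mult_ac)
    qed (auto simp: indicator_def)
  qed
  also have "\<dots> = (\<integral>\<^sup>+r. (\<integral>\<^sup>+s. ?w t s * (?w a r * ennreal (exp (- ((1 + 2 * s2 * s) * r)))) \<partial>lborel) \<partial>lborel)"
    by (intro lborel_pair.Fubini') measurable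
  also have "\<dots> = (\<integral>\<^sup>+r. ennreal (Gamma t * (2 * s2) powr - t) * ennreal (indicator {0..} r * r powr (a - t - 1) * exp (- (1 * r))) \<partial>lborel)"
  proof (intro nn_integral_cong)
    fix r :: real
    show "(\<integral>\<^sup>+s. ?w t s * (?w a r * ennreal (exp (- ((1 + 2 * s2 * s) * r)))) \<partial>lborel)
      = ennreal (Gamma t * (2 * s2) powr - t) * ennreal (indicator {0..} r * r powr (a - t - 1) * exp (- (1 * r)))"
    proof (cases "r > 0")
      case True
      have "(\<integral>\<^sup>+s. ?w t s * (?w a r * ennreal (exp (- ((1 + 2 * s2 * s) * r)))) \<partial>lborel)
        = (\<integral>\<^sup>+s. ennreal (r powr (a - 1) * exp (- r)) * ennreal (indicator {0..} s * s powr (t - 1) * exp (- ((2 * s2 * r) * s))) \<partial>lborel)"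
        using True by (intro nn_integral_cong) (auto simp: ennreal_mult'[symmetric] indicator_def algebra_simps exp_add exp_diff exp_minus field_simps)
      also have "\<dots> = ennreal (r powr (a - 1) * exp (- r)) * ennreal (Gamma t * (2 * s2 * r) powr - t)"
        using True s2 t by (subst nn_integral_cmult) (auto simp: nn_integral_powr_exp)
      also have "\<dots> = ennreal (Gamma t * (2 * s2) powr - t) * ennreal (indicator {0..} r * r powr (a - t - 1) * exp (- (1 * r)))"
        using True s2 G by (simp add: ennreal_mult'[symmetric] powr_mult powr_diff powr_minus powr_add field_simps)
      finally show ?thesis .
    qed (auto simp: indicator_def)
  qed
  also have "\<dots> = ennreal (Gamma t * (2 * s2) powr - t) * ennreal (Gamma (a - t))"
    using a nn_integral_powr_exp[of "a - t" 1] by (subst nn_integral_cmult) auto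
  finally have 2: "ennreal (Gamma a) * (ennreal (Gamma t) * (\<integral>\<^sup>+\<phi>. npow t (\<Sum>i\<in>I. (\<phi> i)\<^sup>2) \<partial>gaussP I s2))
     = ennreal (Gamma t * (2 * s2) powr - t) * ennreal (Gamma (a - t))"
    unfolding 1 .
  let ?E = "\<integral>\<^sup>+\<phi>. npow t (\<Sum>i\<in>I. (\<phi> i)\<^sup>2) \<partial>gaussP I s2"
  \<comment> \<open>The right-hand side of \<open>2\<close> is finite and both Gamma factors on the
    left are positive, so the expectation is finite and the equation can be solved for it in the
    reals.\<close>
  have "?E \<noteq> Orderings.top"
  proof
    assume "?E = Orderings.top"
    with 2 G show False by (simp add: ennreal_mult_top flip: ennreal_mult'')
  qed
  then obtain e where e: "?E = ennreal e" "e \<ge> 0" by (cases ?E) auto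
  have "Gamma a * (Gamma t * e) = Gamma t * (2 * s2) powr - t * Gamma (a - t)"
    using 2 G e by (simp flip: ennreal_mult)
  then have "e = chi_nmom s2 t (card I)"
    using G by (simp add: chi_nmom_def a_def field_simps)
  with e show ?thesis by simp
qed

lemma chi_nmom_pos: "s2 > 0 \<Longrightarrow> 0 < t \<Longrightarrow> 2 * t < real k \<Longrightarrow> chi_nmom s2 t k > 0"
  unfolding chi_nmom_def by (intro divide_pos_pos mult_pos_pos Gamma_real_pos) auto

text \<open>The power \<open>- 1 / t\<close> of the moment equals \<open>2 * s2\<close> times the
  exponential of the difference quotient of \<open>ln_Gamma\<close> at \<open>k / 2\<close> with
  increment \<open>- t\<close>, and the derivative of \<open>ln_Gamma\<close> is the digamma
  function.\<close>

lemma chi_nmom_tendsto: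
  assumes "s2 > 0" "k > 0"
  shows "((\<lambda>t. chi_nmom s2 t k powr (- 1 / t)) \<longlongrightarrow> 2 * s2 * exp (Digamma (real k / 2))) (at_right 0)"
proof -
  define a where "a = real k / 2"
  have a: "a > 0" using assms by (simp add: a_def)
  have "((\<lambda>h. ln_Gamma (a + h)) has_field_derivative Digamma a) (at 0)"
    using has_field_derivative_ln_Gamma_real[OF a] DERIV_shift[of ln_Gamma "Digamma a" 0 a]
    by (simp add: add.commute)
  then have D: "((\<lambda>h. (ln_Gamma (a + h) - ln_Gamma a) / h) \<longlongrightarrow> Digamma a) (at 0)"
    by (simp add: has_field_derivative_def DERIV_def field_has_derivative_at has_field_derivative_iff)
  have "((\<lambda>t. (ln_Gamma (a + - t) - ln_Gamma a) / - t) \<longlongrightarrow> Digamma a) (at_right 0)"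
    by (rule filterlim_compose[OF D]) (auto intro!: filterlim_atI tendsto_eq_intros simp: eventually_at_filter)
  then have "((\<lambda>t. 2 * s2 * exp ((ln_Gamma (a + - t) - ln_Gamma a) / - t)) \<longlongrightarrow> 2 * s2 * exp (Digamma a)) (at_right 0)"
    by (intro tendsto_intros)
  moreover have "\<forall>\<^sub>F t in at_right 0. 2 * s2 * exp ((ln_Gamma (a + - t) - ln_Gamma a) / - t) = chi_nmom s2 t k powr (- 1 / t)"
    unfolding eventually_at_right_field
  proof (intro exI[of _ a] conjI allI impI a)
    fix t :: real assume t: "0 < t" "t < a"
    have G: "Gamma (a - t) > 0" "Gamma a > 0" using t a by (auto intro: Gamma_real_pos)
    have "chi_nmom s2 t k powr (- 1 / t) = ((2 * s2) powr - t) powr (- 1 / t) * (Gamma (a - t) / Gamma a) powr (- 1 / t)"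
      using G assms by (simp add: chi_nmom_def a_def powr_mult flip: times_divide_eq_right)
    also have "((2 * s2) powr - t) powr (- 1 / t) = 2 * s2"
      using t assms by (simp add: powr_powr)
    also have "(Gamma (a - t) / Gamma a) powr (- 1 / t) = exp ((ln_Gamma (a - t) - ln_Gamma a) / - t)"
      using G[THEN less_imp_neq] t a by (simp add: powr_def ln_div ln_Gamma_real_pos)
    finally show "2 * s2 * exp ((ln_Gamma (a + - t) - ln_Gamma a) / - t) = chi_nmom s2 t k powr (- 1 / t)" by simp
  qed
  ultimately show ?thesis unfolding a_def by (rule Lim_transform_eventually)
qed

subsection \<open>Lower bounds for geometric means\<close>

text \<open>The minorant \<open>L\<close> makes it unnecessary to show that \<open>ln f\<close> itself is integrable.\<close>

definition gmean_ge :: "'a measure \<Rightarrow> ('a \<Rightarrow> real) \<Rightarrow> real \<Rightarrow> bool" where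
  "gmean_ge M f p \<longleftrightarrow> p > 0 \<and>
     (\<exists>L. integrable M L \<and> (AE x in M. 0 < f x \<and> L x \<le> ln (f x)) \<and> ln p \<le> (\<integral>x. L x \<partial>M))"

text \<open>Jensen's inequality in explicit form: \<open>1 + y \<le> exp y\<close> at
  \<open>y = - t * ln (f x / p)\<close> bounds \<open>ln (f x)\<close> from below by an integrable
  function of \<open>f x powr - t\<close>.\<close>

lemma gmean_ge_npow:
  assumes "prob_space M" "t > 0" "p > 0" "f \<in> borel_measurable M"
    and eq: "(\<integral>\<^sup>+x. npow t (f x) \<partial>M) = ennreal (p powr - t)"
  shows "gmean_ge M f p"
proof -
  interpret prob_space M by fact
  note [measurable] = assms(4)
  have "AE x in M. npow t (f x) \<noteq> Orderings.top"
    using eq by (intro nn_integral_PInf_AE[unfolded infinity_ennreal_def]) auto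
  then have pos: "AE x in M. f x > 0"
    by eventually_elim (auto simp: npow_def split: if_splits)
  have eq': "(\<integral>\<^sup>+x. ennreal (f x powr - t) \<partial>M) = ennreal (p powr - t)"
    unfolding eq[symmetric] using pos by (intro nn_integral_cong_AE) (auto simp: npow_def elim!: eventually_mono)
  have int: "integrable M (\<lambda>x. f x powr - t)"
    using eq' by (intro integrableI_nonneg) auto
  have val: "(\<integral>x. f x powr - t \<partial>M) = p powr - t"
    using eq' by (intro integral_eq_nn_integral[THEN trans]) auto
  \<comment> \<open>The tangent bound is centred at \<open>p\<close>, so the given moment makes the
    mean of \<open>L\<close> exactly \<open>ln p\<close>.\<close>
  define L where "L x = ln p + (1 - p powr t * f x powr - t) / t" for x
  have "integrable M L"
    unfolding L_def using int by simp
  moreover have "(\<integral>x. L x \<partial>M) = ln p"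
    unfolding L_def using int assms(2,3) by (simp add: val prob_space flip: powr_add)
  moreover have "AE x in M. 0 < f x \<and> L x \<le> ln (f x)"
    using pos
  proof eventually_elim
    fix x assume x: "f x > 0"
    have "1 + - t * ln (f x / p) \<le> exp (- t * ln (f x / p))"
      by (rule exp_ge_add_one_self)
    also have "\<dots> = p powr t * f x powr - t"
      using x assms(3) by (simp add: powr_def ln_div algebra_simps flip: exp_add)
    finally have "1 - p powr t * f x powr - t \<le> t * (ln (f x) - ln p)"
      using x assms(3) by (simp add: ln_div)
    then have "(1 - p powr t * f x powr - t) / t \<le> ln (f x) - ln p"
      using assms(2) by (simp add: field_simps)
    then show "0 < f x \<and> L x \<le> ln (f x)"
      using x by (simp add: L_def)
  qed
  ultimately show ?thesis unfolding gmean_ge_def using assms(3) by auto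
qed

lemma gmean_ge_const:
  assumes "prob_space M" "p > 0"
  shows "gmean_ge M (\<lambda>_. p) p"
proof -
  interpret prob_space M by fact
  show ?thesis unfolding gmean_ge_def using assms(2)
    by (auto intro!: exI[of _ "\<lambda>_. ln p"] simp: prob_space)
qed

lemma gmean_ge_cmult:
  assumes "prob_space M" "a > 0" "gmean_ge M f p"
  shows "gmean_ge M (\<lambda>x. a * f x) (a * p)"
proof -
  interpret prob_space M by fact
  from assms(3) obtain L where L: "p > 0" "integrable M L" "AE x in M. 0 < f x \<and> L x \<le> ln (f x)" "ln p \<le> (\<integral>x. L x \<partial>M)"
    by (auto simp: gmean_ge_def)
  have "AE x in M. 0 < a * f x \<and> ln a + L x \<le> ln (a * f x)"
    using L(3) by eventually_elim (use assms(2) in \<open>simp add: ln_mult\<close>)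
  then show ?thesis unfolding gmean_ge_def
    using L assms(2)
    by (intro conjI exI[of _ "\<lambda>x. ln a + L x"]) (simp_all add: prob_space ln_mult)
qed

text \<open>Superadditivity of the geometric mean: with weights \<open>u = p / (p + q)\<close> and \<open>v = q / (p + q)\<close>,
  concavity of the logarithm gives \<open>ln (f + g) \<ge> ln (p + q) + u ln (f / p) + v ln (g / q)\<close>.\<close>

lemma gmean_ge_add:
  assumes "prob_space M" "gmean_ge M f p" "gmean_ge M g q"
  shows "gmean_ge M (\<lambda>x. f x + g x) (p + q)"
proof -
  interpret prob_space M by fact
  from assms(2) obtain L where L: "p > 0" "integrable M L" "AE x in M. 0 < f x \<and> L x \<le> ln (f x)" "ln p \<le> (\<integral>x. L x \<partial>M)"
    by (auto simp: gmean_ge_def)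
  from assms(3) obtain K where K: "q > 0" "integrable M K" "AE x in M. 0 < g x \<and> K x \<le> ln (g x)" "ln q \<le> (\<integral>x. K x \<partial>M)"
    by (auto simp: gmean_ge_def)
  define u where "u = p / (p + q)"
  define v where "v = q / (p + q)"
  have uv: "u > 0" "v > 0" "u + v = 1" using L(1) K(1) by (auto simp: u_def v_def add_divide_distrib[symmetric])
  have u: "1 - v = u" using uv by simp
  define N where "N x = ln (p + q) + u * (L x - ln p) + v * (K x - ln q)" for x
  have "integrable M N" unfolding N_def using L K by simp
  moreover have "ln (p + q) \<le> (\<integral>x. N x \<partial>M)"
    unfolding N_def using L K uv by (simp add: prob_space)
  moreover have "AE x in M. 0 < f x + g x \<and> N x \<le> ln (f x + g x)"
    using L(3) K(3)
  proof eventually_elim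
    fix x assume f: "0 < f x \<and> L x \<le> ln (f x)" and g: "0 < g x \<and> K x \<le> ln (g x)"
    have "u * ln (f x / p) + v * ln (g x / q) \<le> ln (u * (f x / p) + v * (g x / q))"
      using concave_onD[OF ln_concave, of v "f x / p" "g x / q"] uv f g L(1) K(1) u
      by simp
    also have "u * (f x / p) + v * (g x / q) = (f x + g x) / (p + q)"
      using L(1) K(1) by (simp add: u_def v_def add_divide_distrib)
    finally have "u * (ln (f x) - ln p) + v * (ln (g x) - ln q) \<le> ln (f x + g x) - ln (p + q)"
      using f g L(1) K(1) by (simp add: ln_div)
    moreover have "u * (L x - ln p) \<le> u * (ln (f x) - ln p)" "v * (K x - ln q) \<le> v * (ln (g x) - ln q)"
      using f g uv by auto
    ultimately show "0 < f x + g x \<and> N x \<le> ln (f x + g x)"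
      using f g by (simp add: N_def)
  qed
  ultimately show ?thesis unfolding gmean_ge_def using L K by auto
qed

lemma gmean_ge_sum:
  assumes "prob_space M" "finite S" "S \<noteq> {}" "\<And>i. i \<in> S \<Longrightarrow> gmean_ge M (f i) (p i)"
  shows "gmean_ge M (\<lambda>x. \<Sum>i\<in>S. f i x) (\<Sum>i\<in>S. p i)"
  using assms(2-4)
  by (induction rule: finite_ne_induct) (auto intro: gmean_ge_add[OF assms(1)])

text \<open>Transfers a bound along a map that carries one law to another: rotations of a Gaussian
  array, or a selection of some of its entries.\<close>

lemma gmean_ge_distr:
  assumes "T \<in> measurable M N" "distr M N T = N" "gmean_ge N f p"
  shows "gmean_ge M (\<lambda>x. f (T x)) p"
proof -
  from assms(3) obtain L where L: "p > 0" "integrable N L" "AE x in N. 0 < f x \<and> L x \<le> ln (f x)" "ln p \<le> (\<integral>x. L x \<partial>N)"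
    by (auto simp: gmean_ge_def)
  note [measurable] = assms(1) borel_measurable_integrable[OF L(2)]
  have "integrable M (\<lambda>x. L (T x))"
    using L(2) integrable_distr_eq[of T M N L] assms(2) by simp
  moreover have "(\<integral>x. L (T x) \<partial>M) = (\<integral>x. L x \<partial>N)"
    using integral_distr[of T M N L] assms(2) by simp
  moreover have "AE x in M. 0 < f (T x) \<and> L (T x) \<le> ln (f (T x))"
    by (rule AE_distrD[OF assms(1)], unfold assms(2), rule L(3))
  ultimately show ?thesis unfolding gmean_ge_def using L by auto
qed

lemma gmean_ge_cong:
  "(\<And>x. f x = g x) \<Longrightarrow> gmean_ge M f p \<Longrightarrow> gmean_ge M g p"
  by (simp add: gmean_ge_def)

text \<open>\<open>ennreal\<close> cuts negative values off at 0, so the right-hand side integrates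
  the positive part of the logarithm; this dominates the positive part of the minorant, hence its
  mean.\<close>

lemma gmean_ge_nn_integral_log:
  assumes "gmean_ge M f p"
  shows "ennreal (log 2 p) \<le> (\<integral>\<^sup>+x. ennreal (log 2 (f x)) \<partial>M)"
proof -
  from assms obtain L where L: "p > 0" "integrable M L" "AE x in M. 0 < f x \<and> L x \<le> ln (f x)" "ln p \<le> (\<integral>x. L x \<partial>M)"
    by (auto simp: gmean_ge_def)
  have "log 2 p \<le> (\<integral>x. L x / ln 2 \<partial>M)"
    using L by (simp add: log_def divide_right_mono)
  also have "\<dots> \<le> (\<integral>x. max 0 (L x / ln 2) \<partial>M)"
    using L by (intro integral_mono) auto
  finally have "ennreal (log 2 p) \<le> ennreal (\<integral>x. max 0 (L x / ln 2) \<partial>M)"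
    by (rule ennreal_leI)
  also have "\<dots> = (\<integral>\<^sup>+x. ennreal (max 0 (L x / ln 2)) \<partial>M)"
    using L by (intro nn_integral_eq_integral[symmetric]) auto
  also have "\<dots> \<le> (\<integral>\<^sup>+x. ennreal (log 2 (f x)) \<partial>M)"
  proof (intro nn_integral_mono_AE)
    show "AE x in M. ennreal (max 0 (L x / ln 2)) \<le> ennreal (log 2 (f x))"
      using L(3) by eventually_elim
        (auto simp: log_def max_def intro!: ennreal_leI divide_right_mono)
  qed
  finally show ?thesis .
qed

subsection \<open>Rotation invariance of Gaussian product measures\<close>

text \<open>For \<open>c \<noteq> 0\<close> the rotation is a composition of two affine
  substitutions, each in one variable only, with Tonelli's theorem in between; the two factors
  \<open>\<bar>c\<bar>\<close> cancel. For \<open>c = 0\<close> it exchanges the variables up to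
  signs.\<close>

lemma nn_integral_lborel_rotate:
  fixes c s :: real
  assumes h [measurable]: "h \<in> borel_measurable (borel \<Otimes>\<^sub>M borel)" and cs: "c\<^sup>2 + s\<^sup>2 = 1"
  shows "(\<integral>\<^sup>+b. (\<integral>\<^sup>+a. h (c * a + s * b, - s * a + c * b) \<partial>lborel) \<partial>lborel)
       = (\<integral>\<^sup>+b. (\<integral>\<^sup>+a. h (a, b) \<partial>lborel) \<partial>lborel)" (is "?L = ?R")
proof (cases "c = 0")
  case True
  then have "s\<^sup>2 = 1" using cs by simp
  then have s: "\<bar>s\<bar> = 1" "s \<noteq> 0" by (auto simp: power2_eq_1_iff)
  have "?R = (\<integral>\<^sup>+a. (\<integral>\<^sup>+b. h (a, b) \<partial>lborel) \<partial>lborel)"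
    by (intro lborel_pair.Fubini') measurable
  also have "\<dots> = \<bar>s\<bar> * (\<integral>\<^sup>+b. (\<integral>\<^sup>+a. h (0 + s * b, a) \<partial>lborel) \<partial>lborel)"
    using s by (intro nn_integral_real_affine) auto
  also have "\<dots> = (\<integral>\<^sup>+b. \<bar>-s\<bar> * (\<integral>\<^sup>+a. h (0 + s * b, 0 + (- s) * a) \<partial>lborel) \<partial>lborel)"
    using s by (subst nn_integral_real_affine[of _ "-s" 0]) auto
  also have "\<dots> = ?L" using s True by simp
  finally show ?thesis ..
next
  case False
  have "\<bar>c\<bar> * ?L = (\<integral>\<^sup>+b. \<bar>c\<bar> * (\<integral>\<^sup>+a. h (c * a + s * b, - s * a + c * b) \<partial>lborel) \<partial>lborel)"
    by (intro nn_integral_cmult[symmetric]) measurable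
  also have "\<dots> = (\<integral>\<^sup>+b. (\<integral>\<^sup>+a. h (a, (b - s * a) / c) \<partial>lborel) \<partial>lborel)"
  proof (intro nn_integral_cong)
    fix b :: real
    have *: "(b - s * (c * a + s * b)) / c = c * b - s * a" for a
    proof -
      have "b - s * (c * a + s * b) = (1 - s\<^sup>2) * b - s * c * a"
        by (simp add: algebra_simps power2_eq_square)
      also have "1 - s\<^sup>2 = c\<^sup>2" using cs by simp
      finally show ?thesis using False by (simp add: field_simps power2_eq_square)
    qed
    show "\<bar>c\<bar> * (\<integral>\<^sup>+a. h (c * a + s * b, - s * a + c * b) \<partial>lborel) = (\<integral>\<^sup>+a. h (a, (b - s * a) / c) \<partial>lborel)"
      using False by (subst nn_integral_real_affine[where f = "\<lambda>a. h (a, (b - s * a) / c)" and c = c and t = "s * b"]) (auto simp: * add.commute)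
  qed
  also have "\<dots> = (\<integral>\<^sup>+a. (\<integral>\<^sup>+b. h (a, (b - s * a) / c) \<partial>lborel) \<partial>lborel)"
    by (intro lborel_pair.Fubini') measurable
  also have "\<dots> = (\<integral>\<^sup>+a. \<bar>c\<bar> * (\<integral>\<^sup>+b. h (a, b) \<partial>lborel) \<partial>lborel)"
  proof (intro nn_integral_cong)
    fix a :: real
    show "(\<integral>\<^sup>+b. h (a, (b - s * a) / c) \<partial>lborel) = \<bar>c\<bar> * (\<integral>\<^sup>+b. h (a, b) \<partial>lborel)"
      using False by (subst nn_integral_real_affine[where f = "\<lambda>b. h (a, (b - s * a) / c)" and c = c and t = "s * a"]) simp_all
  qed
  also have "\<dots> = \<bar>c\<bar> * (\<integral>\<^sup>+a. (\<integral>\<^sup>+b. h (a, b) \<partial>lborel) \<partial>lborel)"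
    by (intro nn_integral_cmult) measurable
  also have "(\<integral>\<^sup>+a. (\<integral>\<^sup>+b. h (a, b) \<partial>lborel) \<partial>lborel) = ?R"
    by (intro lborel_pair.Fubini') measurable
  finally show ?thesis
    using False by (simp add: ennreal_mult_cancel_left)
qed

text \<open>The product of the two densities depends on \<open>a\<^sup>2 + b\<^sup>2\<close> alone.
  It is therefore absorbed into the integrand, and the invariance of Lebesgue measure
  applies.\<close>

lemma nn_integral_gauss_rotate:
  fixes c s :: real
  assumes h [measurable]: "h \<in> borel_measurable (borel \<Otimes>\<^sub>M borel)" and cs: "c\<^sup>2 + s\<^sup>2 = 1"
  shows "(\<integral>\<^sup>+b. (\<integral>\<^sup>+a. h (c * a + s * b, - s * a + c * b) \<partial>gauss s2) \<partial>gauss s2)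
       = (\<integral>\<^sup>+b. (\<integral>\<^sup>+a. h (a, b) \<partial>gauss s2) \<partial>gauss s2)"
proof -
  let ?n = "\<lambda>x. ennreal (normal_density 0 (sqrt s2) x)"
  have n: "?n (c * a + s * b) * ?n (- s * a + c * b) = ?n a * ?n b" for a b
  proof -
    have "(c * a + s * b)\<^sup>2 + (- s * a + c * b)\<^sup>2 = (c\<^sup>2 + s\<^sup>2) * (a\<^sup>2 + b\<^sup>2)"
      by (simp add: power2_eq_square algebra_simps)
    then have q: "(c * a + s * b)\<^sup>2 + (- s * a + c * b)\<^sup>2 = a\<^sup>2 + b\<^sup>2" using cs by simp
    have m: "normal_density 0 (sqrt s2) x * normal_density 0 (sqrt s2) y
      = (1 / sqrt (2 * pi * (sqrt s2)\<^sup>2))\<^sup>2 * exp (- (x\<^sup>2 + y\<^sup>2) / (2 * (sqrt s2)\<^sup>2))" for x y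
      unfolding normal_density_def diff_0_right minus_add_distrib add_divide_distrib exp_add power2_eq_square[of "1 / _"]
      by (simp only: mult_ac)
    show ?thesis by (simp only: ennreal_mult'[symmetric] normal_density_nonneg m q)
  qed
  have *: "(\<integral>\<^sup>+b. (\<integral>\<^sup>+a. f a b \<partial>gauss s2) \<partial>gauss s2) = (\<integral>\<^sup>+b. (\<integral>\<^sup>+a. ?n a * ?n b * f a b \<partial>lborel) \<partial>lborel)"
    if [measurable]: "(\<lambda>(a, b). f a b) \<in> borel_measurable (borel \<Otimes>\<^sub>M borel)" for f :: "real \<Rightarrow> real \<Rightarrow> ennreal"
  proof -
    have "(\<integral>\<^sup>+a. f a b \<partial>gauss s2) = (\<integral>\<^sup>+a. ?n a * f a b \<partial>lborel)" for b
      by (intro nn_integral_density) measurable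
    then have "(\<integral>\<^sup>+b. (\<integral>\<^sup>+a. f a b \<partial>gauss s2) \<partial>gauss s2) = (\<integral>\<^sup>+b. (\<integral>\<^sup>+a. ?n a * f a b \<partial>lborel) \<partial>gauss s2)"
      by simp
    also have "\<dots> = (\<integral>\<^sup>+b. ?n b * (\<integral>\<^sup>+a. ?n a * f a b \<partial>lborel) \<partial>lborel)"
      by (intro nn_integral_density) measurable
    also have "\<dots> = (\<integral>\<^sup>+b. (\<integral>\<^sup>+a. ?n a * ?n b * f a b \<partial>lborel) \<partial>lborel)"
      by (intro nn_integral_cong, subst nn_integral_cmult[symmetric]) (auto simp: mult_ac)
    finally show ?thesis .
  qed
  have "(\<integral>\<^sup>+b. (\<integral>\<^sup>+a. h (c * a + s * b, - s * a + c * b) \<partial>gauss s2) \<partial>gauss s2)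
     = (\<integral>\<^sup>+b. (\<integral>\<^sup>+a. (case (c * a + s * b, - s * a + c * b) of (a, b) \<Rightarrow> ?n a * ?n b * h (a, b)) \<partial>lborel) \<partial>lborel)"
    unfolding prod.case n by (intro *) measurable
  also have "\<dots> = (\<integral>\<^sup>+b. (\<integral>\<^sup>+a. (case (a, b) of (a, b) \<Rightarrow> ?n a * ?n b * h (a, b)) \<partial>lborel) \<partial>lborel)"
    by (rule nn_integral_lborel_rotate[OF _ cs]) measurable
  also have "\<dots> = (\<integral>\<^sup>+b. (\<integral>\<^sup>+a. h (a, b) \<partial>gauss s2) \<partial>gauss s2)"
    unfolding prod.case by (intro *[symmetric]) measurable
  finally show ?thesis .
qed

definition givens :: "real \<Rightarrow> real \<Rightarrow> 'i \<Rightarrow> 'i \<Rightarrow> ('i \<Rightarrow> real) \<Rightarrow> 'i \<Rightarrow> real" where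
  "givens c s i j \<phi> = \<phi>(i := c * \<phi> i + s * \<phi> j, j := - s * \<phi> i + c * \<phi> j)"

lemma givens_measurable:
  assumes "i \<in> I" "j \<in> I"
  shows "givens c s i j \<in> measurable (gaussP I s2) (gaussP I s2)"
proof (rule measurable_PiM_single')
  show "givens c s i j \<in> space (gaussP I s2) \<rightarrow> (\<Pi>\<^sub>E i\<in>I. space (gauss s2))"
    using assms by (auto simp: space_PiM givens_def PiE_def extensional_def)
  show "(\<lambda>\<phi>. givens c s i j \<phi> k) \<in> measurable (gaussP I s2) (gauss s2)" if "k \<in> I" for k
    using that assms by (cases "k = j"; cases "k = i") (auto simp: givens_def)
qed

text \<open>By Tonelli's theorem the coordinates \<open>i\<close> and \<open>j\<close> are
  integrated first, with all others frozen; this reduces the claim to invariance in the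
  plane.\<close>

lemma distr_givens:
  assumes s2: "s2 > 0" and I: "finite I" "i \<in> I" "j \<in> I" "i \<noteq> j" and cs: "c\<^sup>2 + s\<^sup>2 = 1"
  shows "distr (gaussP I s2) (gaussP I s2) (givens c s i j) = gaussP I s2"
proof (rule measure_eqI)
  fix A assume "A \<in> sets (distr (gaussP I s2) (gaussP I s2) (givens c s i j))"
  then have A [measurable]: "A \<in> sets (gaussP I s2)" by simp
  interpret product_sigma_finite "\<lambda>_ :: 'a. gauss s2" by (rule product_sigma_finite_gauss[OF s2])
  note [measurable] = givens_measurable[OF I(2,3), of c s s2]
  define K where "K = I - {i, j}"
  have K: "I = insert i (insert j K)" "finite K" "i \<notin> insert j K" "j \<notin> K" using I by (auto simp: K_def)
  \<comment> \<open>The indicator of \<open>A\<close> as a function of the two rotated coordinates,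
    the others being given by \<open>x\<close>.\<close>
  define D where "D x a b = (indicator A (x(j := b, i := a)) :: ennreal)" for x :: "'a \<Rightarrow> real" and a b :: real
  have fold: "(\<integral>\<^sup>+\<phi>. f \<phi> \<partial>gaussP I s2) = (\<integral>\<^sup>+x. (\<integral>\<^sup>+b. (\<integral>\<^sup>+a. f (x(j := b, i := a)) \<partial>gauss s2) \<partial>gauss s2) \<partial>gaussP K s2)"
    if f: "f \<in> borel_measurable (gaussP I s2)" for f :: "('a \<Rightarrow> real) \<Rightarrow> ennreal"
  proof -
    interpret i: sigma_finite_measure "gauss s2" by (intro prob_space_imp_sigma_finite prob_space_gauss s2)
    have f': "f \<in> borel_measurable (gaussP (insert i (insert j K)) s2)" using f K by simp
    have m: "(\<lambda>x. \<integral>\<^sup>+a. f (x(i := a)) \<partial>gauss s2) \<in> borel_measurable (gaussP (insert j K) s2)"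
      using f' by measurable
    show ?thesis
      unfolding K(1) using K f' m
      by (subst product_nn_integral_insert[OF _ K(3) f'], simp)
        (rule product_nn_integral_insert[OF K(2,4) m])
  qed
  have gm: "(\<lambda>\<phi>. indicator A (givens c s i j \<phi>) :: ennreal) \<in> borel_measurable (gaussP I s2)"
    by measurable
  have "givens c s i j (x(j := b, i := a)) = x(j := - s * a + c * b, i := c * a + s * b)" for x a b
    using I(4) by (auto simp: givens_def fun_eq_iff)
  then have geq: "indicator A (givens c s i j (x(j := b, i := a))) = D x (c * a + s * b) (- s * a + c * b)" for x a b
    by (simp add: D_def)
  have "emeasure (distr (gaussP I s2) (gaussP I s2) (givens c s i j)) A
     = (\<integral>\<^sup>+\<phi>. indicator A (givens c s i j \<phi>) \<partial>gaussP I s2)"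
    using A by (subst nn_integral_indicator[symmetric], simp, subst nn_integral_distr) measurable
  also have "\<dots> = (\<integral>\<^sup>+x. (\<integral>\<^sup>+b. (\<integral>\<^sup>+a. D x (c * a + s * b) (- s * a + c * b) \<partial>gauss s2) \<partial>gauss s2) \<partial>gaussP K s2)"
    unfolding fold[OF gm] geq ..
  also have "\<dots> = (\<integral>\<^sup>+x. (\<integral>\<^sup>+b. (\<integral>\<^sup>+a. D x a b \<partial>gauss s2) \<partial>gauss s2) \<partial>gaussP K s2)"
  proof (rule nn_integral_cong)
    fix x assume x: "x \<in> space (gaussP K s2)"
    have "(\<lambda>p. x(j := snd p, i := fst p)) \<in> measurable (borel \<Otimes>\<^sub>M borel) (gaussP I s2)"
    proof (rule measurable_PiM_single')
      show "(\<lambda>p. x(j := snd p, i := fst p)) \<in> space (borel \<Otimes>\<^sub>M borel) \<rightarrow> (\<Pi>\<^sub>E i\<in>I. space (gauss s2))"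
        using x K by (auto simp: space_PiM PiE_def extensional_def)
      show "(\<lambda>p. (x(j := snd p, i := fst p)) k) \<in> measurable (borel \<Otimes>\<^sub>M borel) (gauss s2)" if "k \<in> I" for k
        by (cases "k = i"; cases "k = j") auto
    qed
    then have "(\<lambda>p. D x (fst p) (snd p)) \<in> borel_measurable (borel \<Otimes>\<^sub>M borel)"
      unfolding D_def by measurable
    from nn_integral_gauss_rotate[OF this cs, of s2]
    show "(\<integral>\<^sup>+b. (\<integral>\<^sup>+a. D x (c * a + s * b) (- s * a + c * b) \<partial>gauss s2) \<partial>gauss s2)
        = (\<integral>\<^sup>+b. (\<integral>\<^sup>+a. D x a b \<partial>gauss s2) \<partial>gauss s2)" by simp
  qed
  also have "\<dots> = emeasure (gaussP I s2) A"
    unfolding D_def using fold[of "indicator A"] by simp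
  finally show "emeasure (distr (gaussP I s2) (gaussP I s2) (givens c s i j)) A = emeasure (gaussP I s2) A" .
qed simp

section \<open>Measure-preserving rotations and alignment of a vector with an axis\<close>

definition meas_pres :: "'a measure \<Rightarrow> ('a \<Rightarrow> 'a) \<Rightarrow> bool" where
  "meas_pres M T \<longleftrightarrow> T \<in> measurable M M \<and> distr M M T = M"

lemma meas_pres_id: "meas_pres M (\<lambda>x. x)"
  by (simp add: meas_pres_def distr_id2)

lemma meas_pres_comp: "meas_pres M T \<Longrightarrow> meas_pres M S \<Longrightarrow> meas_pres M (\<lambda>x. T (S x))"
  unfolding meas_pres_def
  using distr_distr[of T M M S M] by (auto simp: comp_def)

lemma meas_pres_givens:
  "s2 > 0 \<Longrightarrow> finite I \<Longrightarrow> i \<in> I \<Longrightarrow> j \<in> I \<Longrightarrow> i \<noteq> j \<Longrightarrow> c\<^sup>2 + s\<^sup>2 = 1 \<Longrightarrow>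
    meas_pres (gaussP I s2) (givens c s i j)"
  by (simp add: meas_pres_def givens_measurable distr_givens)

text \<open>A coordinate system \<open>e\<close> on the entries of a Gaussian matrix: \<open>e a k\<close> is either \<open>(a, k)\<close> or
  \<open>(k, a)\<close>, so that columns and rows can be rotated by the same argument.\<close>

definition slice_rot :: "(nat \<Rightarrow> nat \<Rightarrow> 'i) \<Rightarrow> nat \<Rightarrow> nat \<Rightarrow> real \<Rightarrow> real \<Rightarrow> nat \<Rightarrow> nat \<Rightarrow>
    ('i \<Rightarrow> real) \<Rightarrow> ('i \<Rightarrow> real) \<Rightarrow> bool" where
  "slice_rot e n m c s k l \<phi> \<phi>' \<longleftrightarrow> (\<forall>a<n. \<phi>' (e a k) = c * \<phi> (e a k) + s * \<phi> (e a l) \<and>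
     \<phi>' (e a l) = - s * \<phi> (e a k) + c * \<phi> (e a l) \<and> (\<forall>b<m. b \<noteq> k \<longrightarrow> b \<noteq> l \<longrightarrow> \<phi>' (e a b) = \<phi> (e a b)))"

text \<open>One Givens rotation per slice, composed by induction on the number of slices.
  Injectivity of \<open>e\<close> keeps the slices disjoint. The last clause carries the induction:
  the rotation of slice \<open>n\<close> must meet the original entries there.\<close>

lemma ex_slice_rot:
  assumes s2: "s2 > 0" and I: "finite I" "\<And>a b. a < n \<Longrightarrow> b < m \<Longrightarrow> e a b \<in> I"
    and e: "\<And>a b a' b'. e a b = e a' b' \<longleftrightarrow> a = a' \<and> b = b'"
    and kl: "k < m" "l < m" "k \<noteq> l" and cs: "c\<^sup>2 + s\<^sup>2 = 1"
  shows "\<exists>T. meas_pres (gaussP I s2) T \<and> (\<forall>\<phi>. slice_rot e n m c s k l \<phi> (T \<phi>)) \<and>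
    (\<forall>\<phi> a b. n \<le> a \<longrightarrow> T \<phi> (e a b) = \<phi> (e a b))"
  using I(2)
proof (induction n)
  case 0
  show ?case by (rule exI[of _ "\<lambda>x. x"]) (auto simp: meas_pres_id slice_rot_def)
next
  case (Suc n)
  from Suc.IH[OF Suc.prems[OF less_SucI]]
  obtain T where T: "meas_pres (gaussP I s2) T" "\<forall>\<phi>. slice_rot e n m c s k l \<phi> (T \<phi>)"
     "\<forall>\<phi> a b. n \<le> a \<longrightarrow> T \<phi> (e a b) = \<phi> (e a b)" by blast
  let ?T = "\<lambda>\<phi>. givens c s (e n k) (e n l) (T \<phi>)"
  have I': "e n k \<in> I" "e n l \<in> I" "e n k \<noteq> e n l"
    using Suc.prems kl e by auto
  have "meas_pres (gaussP I s2) ?T"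
    by (rule meas_pres_comp[OF meas_pres_givens[OF s2 I(1) I' cs] T(1)])
  moreover have "slice_rot e (Suc n) m c s k l \<phi> (?T \<phi>)" for \<phi>
    unfolding slice_rot_def
  proof (intro allI impI conjI)
    fix a assume a: "a < Suc n"
    have sr: "slice_rot e n m c s k l \<phi> (T \<phi>)" using T(2) by blast
    show "?T \<phi> (e a k) = c * \<phi> (e a k) + s * \<phi> (e a l)"
      using a kl T(3) sr unfolding slice_rot_def by (cases "a = n") (simp_all add: givens_def e)
    show "?T \<phi> (e a l) = - s * \<phi> (e a k) + c * \<phi> (e a l)"
      using a kl T(3) sr unfolding slice_rot_def by (cases "a = n") (simp_all add: givens_def e)
    show "?T \<phi> (e a b) = \<phi> (e a b)" if "b < m" "b \<noteq> k" "b \<noteq> l" for b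
      using that a kl T(3) sr unfolding slice_rot_def by (cases "a = n") (simp_all add: givens_def e)
  qed
  moreover have "?T \<phi> (e a b) = \<phi> (e a b)" if "Suc n \<le> a" for \<phi> a b
    using that T(3) by (simp add: givens_def e)
  ultimately show ?case by (intro exI[of _ ?T]) blast
qed

text \<open>If \<open>F\<close> is invariant under rotating the vector \<open>u\<close> and the
  array together, then \<open>u\<close> may be replaced by a multiple of the axis vector
  \<open>m\<close> at the cost of a measure-preserving change of the array. Only the square of
  \<open>b\<close>, the squared length of \<open>u\<close>, is prescribed.\<close>

lemma ex_rotate_to_axis:
  fixes F :: "(nat \<Rightarrow> real) \<Rightarrow> ('i \<Rightarrow> real) \<Rightarrow> 'b"
  assumes s2: "s2 > 0" and I: "finite I" "\<And>a b. a < n \<Longrightarrow> b < Suc m \<Longrightarrow> e a b \<in> I"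
    and e: "\<And>a b a' b'. e a b = e a' b' \<longleftrightarrow> a = a' \<and> b = b'"
    and F: "\<And>u c s k \<phi> \<phi>'. c\<^sup>2 + s\<^sup>2 = 1 \<Longrightarrow> k < m \<Longrightarrow> slice_rot e n (Suc m) c s k m \<phi> \<phi>' \<Longrightarrow>
        F (givens c s k m u) \<phi>' = F u \<phi>"
    and u: "\<And>i. i > m \<Longrightarrow> u i = 0"
  shows "\<exists>T b. meas_pres (gaussP I s2) T \<and> b\<^sup>2 = (\<Sum>i\<le>m. (u i)\<^sup>2) \<and>
    (\<forall>\<phi>. F u \<phi> = F (\<lambda>i. if i = m then b else 0) (T \<phi>))"
proof -
  \<comment> \<open>Induction on \<open>k\<close>, where only the entries below \<open>k\<close> and
    the entry \<open>m\<close> may be nonzero; each step clears the entry with the highest index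
    below \<open>m\<close>.\<close>
  have "\<exists>T b. meas_pres (gaussP I s2) T \<and> b\<^sup>2 = (\<Sum>i\<le>m. (u i)\<^sup>2) \<and>
    (\<forall>\<phi>. F u \<phi> = F (\<lambda>i. if i = m then b else 0) (T \<phi>))"
    if "\<And>i. i > m \<Longrightarrow> u i = 0" "\<And>i. k \<le> i \<Longrightarrow> i < m \<Longrightarrow> u i = 0" "k \<le> m" for k u
    using that
  proof (induction k arbitrary: u)
    case 0
    have "u = (\<lambda>i. if i = m then u m else 0)"
    proof
      fix i show "u i = (if i = m then u m else 0)"
        using 0 by (cases i m rule: linorder_cases) auto
    qed
    moreover have "(\<Sum>i\<le>m. (u i)\<^sup>2) = (\<Sum>i\<in>{m}. (u i)\<^sup>2)"
      using 0 by (intro sum.mono_neutral_right) auto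
    ultimately show ?case
      by (intro exI[of _ "\<lambda>x. x"] exI[of _ "u m"]) (auto simp: meas_pres_id)
  next
    case (Suc k)
    have km: "k < m" using Suc by simp
    show ?case
    proof (cases "u k = 0")
      case True
      show ?thesis
      proof (rule Suc.IH)
        show "u i = 0" if "k \<le> i" "i < m" for i
          using that True Suc.prems(2)[of i] by (cases "i = k") auto
      qed (use Suc in auto)
    next
      case False
      define r where "r = sqrt ((u k)\<^sup>2 + (u m)\<^sup>2)"
      have r: "r\<^sup>2 = (u k)\<^sup>2 + (u m)\<^sup>2" "r \<noteq> 0" using False by (auto simp: r_def sum_power2_eq_zero_iff)
      \<comment> \<open>The rotation that sends the pair \<open>(u k, u m)\<close> to
        \<open>(0, r)\<close>.\<close>
      define c where "c = u m / r"
      define s where "s = - u k / r"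
      have "c\<^sup>2 + s\<^sup>2 = ((u k)\<^sup>2 + (u m)\<^sup>2) / r\<^sup>2"
        by (simp add: c_def s_def power_divide add_divide_distrib)
      then have cs: "c\<^sup>2 + s\<^sup>2 = 1"
        unfolding r(1)[symmetric] using r(2) by simp
      define v where "v = givens c s k m u"
      have v: "v k = 0" "v m = r" "\<And>i. i \<noteq> k \<Longrightarrow> i \<noteq> m \<Longrightarrow> v i = u i"
        using km r by (auto simp: v_def givens_def c_def s_def field_simps power2_eq_square)
      obtain S where S: "meas_pres (gaussP I s2) S" "\<And>\<phi>. slice_rot e n (Suc m) c s k m \<phi> (S \<phi>)"
        using ex_slice_rot[OF s2 I e, where n = n and m = "Suc m" and k = k and l = m and c = c and s = s] km cs by auto
      have "\<exists>T b. meas_pres (gaussP I s2) T \<and> b\<^sup>2 = (\<Sum>i\<le>m. (v i)\<^sup>2) \<and>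
        (\<forall>\<phi>. F v \<phi> = F (\<lambda>i. if i = m then b else 0) (T \<phi>))"
      proof (rule Suc.IH)
        show "v i = 0" if "k \<le> i" "i < m" for i
          using that v Suc.prems(2)[of i] by (cases "i = k") auto
      qed (use Suc v in auto)
      then obtain T b where T: "meas_pres (gaussP I s2) T" "b\<^sup>2 = (\<Sum>i\<le>m. (v i)\<^sup>2)"
        "\<And>\<phi>. F v \<phi> = F (\<lambda>i. if i = m then b else 0) (T \<phi>)" by auto
      have split: "(\<Sum>i\<le>m. (w i)\<^sup>2) = (w k)\<^sup>2 + (w m)\<^sup>2 + (\<Sum>i\<in>{..m} - {k, m}. (w i)\<^sup>2)" for w :: "nat \<Rightarrow> real"
        using km by (subst sum.subset_diff[of "{k, m}"]) auto
      have "(\<Sum>i\<le>m. (v i)\<^sup>2) = (\<Sum>i\<le>m. (u i)\<^sup>2)"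
        unfolding split using v r by (auto intro!: sum.cong)
      moreover have "F u \<phi> = F (\<lambda>i. if i = m then b else 0) (T (S \<phi>))" for \<phi>
        using F[OF cs km S(2), of u \<phi>] T(3)[of "S \<phi>"] by (simp add: v_def)
      ultimately show ?thesis using T S
        meas_pres_comp[OF T(1) S(1)]
        by (intro exI[of _ "\<lambda>\<phi>. T (S \<phi>)"] exI[of _ b]) simp
    qed
  qed
  from this[of u m] u show ?thesis by auto
qed

subsection \<open>Determinants over finite index sets\<close>

text \<open>Leibniz' formula over an arbitrary index set, so that the principal minor on a subset is
  the same expression with a smaller \<open>S\<close> and requires no renumbering.\<close>

definition ldet :: "'i set \<Rightarrow> ('i \<Rightarrow> 'i \<Rightarrow> 'a::comm_ring_1) \<Rightarrow> 'a" where
  "ldet S K = (\<Sum>p | p permutes S. of_int (sign p) * (\<Prod>i\<in>S. K i (p i)))"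

lemma det_mat_eq_ldet: "det (mat n n (\<lambda>(i, j). K i j)) = ldet {..<n} K"
proof -
  have "det (mat n n (\<lambda>(i, j). K i j)) =
    (\<Sum>p | p permutes {..<n}. of_int (sign p) * (\<Prod>i<n. mat n n (\<lambda>(i, j). K i j) $$ (i, p i)))"
    by (subst det_def'[of _ n]) (auto simp: atLeast0LessThan)
  also have "\<dots> = ldet {..<n} K"
    unfolding ldet_def
  proof (intro sum.cong refl arg_cong2[where f = "(*)"] prod.cong)
    fix p i assume "p \<in> {p. p permutes {..<n}}" "i \<in> {..<n}"
    then have "p i < n" "i < n" using permutes_in_image[of p "{..<n}" i] by auto
    then show "mat n n (\<lambda>(i, j). K i j) $$ (i, p i) = K i (p i)" by simp
  qed
  finally show ?thesis .
qed

lemma ldet_cong: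
  assumes "\<And>i j. i \<in> S \<Longrightarrow> j \<in> S \<Longrightarrow> K i j = K' i j"
  shows "ldet S K = ldet S K'"
  unfolding ldet_def
  by (intro sum.cong refl arg_cong2[where f = "(*)"] prod.cong)
    (use assms permutes_in_image in fastforce)

lemma ldet_empty [simp]: "ldet {} K = 1"
  by (simp add: ldet_def)

lemma ldet_mult:
  fixes f g :: "nat \<Rightarrow> nat \<Rightarrow> 'a::comm_ring_1"
  shows "ldet {..<n} (\<lambda>i j. \<Sum>l<n. f i l * g l j) = ldet {..<n} f * ldet {..<n} g"
proof -
  have "mat n n (\<lambda>(i, j). \<Sum>l<n. f i l * g l j) = mat n n (\<lambda>(i, j). f i j) * mat n n (\<lambda>(i, j). g i j)"
    by (rule eq_matI) (auto simp: scalar_prod_def atLeast0LessThan)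
  then show ?thesis
    unfolding det_mat_eq_ldet[symmetric] by (simp add: det_mult[of _ n])
qed

lemma ldet_transpose:
  fixes K :: "nat \<Rightarrow> nat \<Rightarrow> 'a::comm_ring_1"
  shows "ldet {..<n} (\<lambda>i j. K j i) = ldet {..<n} K"
proof -
  have "mat n n (\<lambda>(i, j). K j i) = transpose_mat (mat n n (\<lambda>(i, j). K i j))"
    by (rule eq_matI) auto
  then show ?thesis
    unfolding det_mat_eq_ldet[symmetric] by (simp add: det_transpose[of _ n])
qed

lemma ldet_id: "ldet {..<n::nat} (\<lambda>i j. if i = j then 1 else 0 :: 'a::comm_ring_1) = 1"
proof -
  have "mat n n (\<lambda>(i, j). if i = j then 1 else 0) = (1\<^sub>m n :: 'a mat)"
    by (rule eq_matI) auto
  then show ?thesis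
    unfolding det_mat_eq_ldet[symmetric] by simp
qed

lemma ldet_of_real:
  "ldet S (\<lambda>i j. of_real (K i j) :: 'a::{real_algebra_1, comm_ring_1}) = of_real (ldet S K)"
  by (simp add: ldet_def)

lemma ldet_row_linear:
  assumes "finite S" "m \<in> S"
  shows "ldet S (\<lambda>i k. if i = m then x k + a * y k else K i k) =
    ldet S (\<lambda>i k. if i = m then x k else K i k) + a * ldet S (\<lambda>i k. if i = m then y k else K i k)"
proof -
  have *: "(\<Prod>i\<in>S. if i = m then z (p i) else K i (p i)) = z (p m) * (\<Prod>i\<in>S - {m}. K i (p i))" for z p
    using assms by (subst prod.remove[of _ m]) (auto intro!: prod.cong)
  show ?thesis
    unfolding ldet_def *[of "\<lambda>k. x k + a * y k"] *[of x] *[of y]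
    by (simp add: sum_distrib_left sum.distrib[symmetric] algebra_simps)
qed

text \<open>A permutation that moves \<open>a\<close> picks one of the zeros of row
  \<open>a\<close>, so only the permutations of \<open>S\<close> contribute.\<close>

lemma ldet_insert_zero_row:
  assumes "finite S" "a \<notin> S" and z: "\<And>l. l \<in> S \<Longrightarrow> K a l = 0"
  shows "ldet (insert a S) K = K a a * ldet S K"
proof -
  have "ldet (insert a S) K =
      (\<Sum>p | p permutes (insert a S). of_int (sign p) * (K a (p a) * (\<Prod>i\<in>S. K i (p i))))"
    using assms by (simp add: ldet_def)
  also have "\<dots> = (\<Sum>p | p permutes S. of_int (sign p) * (K a (p a) * (\<Prod>i\<in>S. K i (p i))))"
  proof (rule sum.mono_neutral_right)
    show "finite {p. p permutes insert a S}" using assms by (simp add: finite_permutations)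
    show "{p. p permutes S} \<subseteq> {p. p permutes insert a S}"
      by (auto intro: permutes_subset)
    show "\<forall>p\<in>{p. p permutes insert a S} - {p. p permutes S}.
        of_int (sign p) * (K a (p a) * (\<Prod>i\<in>S. K i (p i))) = 0"
    proof
      fix p assume p: "p \<in> {p. p permutes insert a S} - {p. p permutes S}"
      then have "p a \<noteq> a"
        using permutes_superset[of p "insert a S" S] by auto
      moreover have "p a \<in> insert a S" using p permutes_in_image[of p "insert a S" a] by auto
      ultimately show "of_int (sign p) * (K a (p a) * (\<Prod>i\<in>S. K i (p i))) = 0" using z by simp
    qed
  qed
  also have "\<dots> = K a a * ldet S K"
    using assms by (auto simp: ldet_def sum_distrib_left permutes_not_in mult_ac intro!: sum.cong)
  finally show ?thesis .
qed

text \<open>Conjugation by \<open>f\<close> is a bijection between the permutations of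
  \<open>A\<close> and those of \<open>B\<close> that preserves signs.\<close>

lemma ldet_reindex:
  assumes f: "bij_betw f A B" and "finite A"
  shows "ldet B K = ldet A (\<lambda>i j. K (f i) (f j))"
proof -
  have fA: "f ` A = B" "inj_on f A" using f by (auto simp: bij_betw_def)
  have bij: "bij_betw (map_permutation A f) {p. p permutes A} {p. p permutes B}"
    using bij_betw_permutations[OF f]
    by (rule bij_betw_cong[THEN iffD1, rotated])
      (auto simp: map_permutation_def restrict_id_def fA fun_eq_iff)
  have "ldet B K = (\<Sum>p | p permutes A. of_int (sign (map_permutation A f p)) *
      (\<Prod>i\<in>B. K i (map_permutation A f p i)))"
    unfolding ldet_def by (rule sum.reindex_bij_betw[OF bij, symmetric])
  also have "\<dots> = (\<Sum>p | p permutes A. of_int (sign p) * (\<Prod>i\<in>A. K (f i) (f (p i))))"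
  proof (intro sum.cong refl arg_cong2[where f = "(*)"])
    fix p assume p: "p \<in> {p. p permutes A}"
    then show "(of_int (sign (map_permutation A f p)) :: 'c) = of_int (sign p)"
      using sign_map_permutation[OF fA(2) _ assms(2), of p] by simp
    have "(\<Prod>i\<in>B. K i (map_permutation A f p i)) = (\<Prod>i\<in>A. K (f i) (map_permutation A f p (f i)))"
      by (rule prod.reindex_bij_betw[OF f, symmetric])
    also have "\<dots> = (\<Prod>i\<in>A. K (f i) (f (p i)))"
      using fA by (intro prod.cong) (auto simp: map_permutation_apply)
    finally show "(\<Prod>i\<in>B. K i (map_permutation A f p i)) = (\<Prod>i\<in>A. K (f i) (f (p i)))" .
  qed
  finally show ?thesis by (simp add: ldet_def)
qed

text \<open>Expanding every product over the set \<open>S\<close> of rows in which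
  \<open>c * K\<close> is chosen, the identity in the other rows kills all permutations that move a
  point outside \<open>S\<close>. What remains is the principal minor on \<open>S\<close>.\<close>

lemma ldet_id_plus:
  fixes K :: "'i \<Rightarrow> 'i \<Rightarrow> 'a::comm_ring_1"
  assumes A: "finite A"
  shows "ldet A (\<lambda>i j. (if i = j then 1 else 0) + c * K i j) = (\<Sum>S\<in>Pow A. c ^ card S * ldet S K)"
proof -
  let ?d = "\<lambda>i j. if i = j then 1 else 0 :: 'a"
  have "ldet A (\<lambda>i j. ?d i j + c * K i j) = (\<Sum>p | p permutes A. \<Sum>S\<in>Pow A.
      of_int (sign p) * ((\<Prod>i\<in>S. c * K i (p i)) * (\<Prod>i\<in>A - S. ?d i (p i))))"
    unfolding ldet_def using A by (subst add.commute) (simp add: prod_add sum_distrib_left)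
  also have "\<dots> = (\<Sum>S\<in>Pow A. \<Sum>p | p permutes A.
      of_int (sign p) * ((\<Prod>i\<in>S. c * K i (p i)) * (\<Prod>i\<in>A - S. ?d i (p i))))"
    by (rule sum.swap)
  also have "\<dots> = (\<Sum>S\<in>Pow A. c ^ card S * ldet S K)"
  proof (intro sum.cong refl)
    fix S assume S: "S \<in> Pow A"
    have "(\<Sum>p | p permutes A. of_int (sign p) * ((\<Prod>i\<in>S. c * K i (p i)) * (\<Prod>i\<in>A - S. ?d i (p i))))
      = (\<Sum>p | p permutes S. of_int (sign p) * ((\<Prod>i\<in>S. c * K i (p i)) * (\<Prod>i\<in>A - S. ?d i (p i))))"
    proof (rule sum.mono_neutral_right)
      show "finite {p. p permutes A}" using A by (simp add: finite_permutations)
      show "{p. p permutes S} \<subseteq> {p. p permutes A}" using S by (auto intro: permutes_subset)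
      show "\<forall>p\<in>{p. p permutes A} - {p. p permutes S}.
        of_int (sign p) * ((\<Prod>i\<in>S. c * K i (p i)) * (\<Prod>i\<in>A - S. ?d i (p i))) = 0"
      proof
        fix p assume p: "p \<in> {p. p permutes A} - {p. p permutes S}"
        then obtain x where x: "x \<in> A - S" "p x \<noteq> x"
          using permutes_superset[of p A S] by auto
        then have "(\<Prod>i\<in>A - S. ?d i (p i)) = 0"
          using A by (intro prod_zero bexI[of _ x]) auto
        then show "of_int (sign p) * ((\<Prod>i\<in>S. c * K i (p i)) * (\<Prod>i\<in>A - S. ?d i (p i))) = 0" by simp
      qed
    qed
    also have "\<dots> = (\<Sum>p | p permutes S. c ^ card S * (of_int (sign p) * (\<Prod>i\<in>S. K i (p i))))"
    proof (intro sum.cong refl)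
      fix p assume "p \<in> {p. p permutes S}"
      then have "(\<Prod>i\<in>A - S. ?d i (p i)) = 1"
        by (intro prod.neutral) (auto simp: permutes_not_in)
      then show "of_int (sign p) * ((\<Prod>i\<in>S. c * K i (p i)) * (\<Prod>i\<in>A - S. ?d i (p i)))
        = c ^ card S * (of_int (sign p) * (\<Prod>i\<in>S. K i (p i)))"
        by (simp add: prod.distrib mult_ac)
    qed
    also have "\<dots> = c ^ card S * ldet S K"
      by (simp add: ldet_def sum_distrib_left)
    finally show "(\<Sum>p | p permutes A. of_int (sign p) * ((\<Prod>i\<in>S. c * K i (p i)) * (\<Prod>i\<in>A - S. ?d i (p i))))
       = c ^ card S * ldet S K" .
  qed
  finally show ?thesis .
qed

text \<open>Sylvester's identity. Multiplying the block matrix \<open>?X\<close> by the unipotent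
  \<open>?Y\<close> on either side makes it block triangular, and the two orders give the two
  determinants.\<close>

lemma det_one_plus_mult_comm:
  fixes A B :: "'a::idom mat"
  assumes A: "A \<in> carrier_mat n m" and B: "B \<in> carrier_mat m n"
  shows "det (1\<^sub>m n + A * B) = det (1\<^sub>m m + B * A)"
proof -
  let ?X = "four_block_mat (1\<^sub>m n) (- A) B (1\<^sub>m m)"
  let ?Y = "four_block_mat (1\<^sub>m n) A (0\<^sub>m m n) (1\<^sub>m m)"
  have c: "?X \<in> carrier_mat (n + m) (n + m)" "?Y \<in> carrier_mat (n + m) (n + m)"
    by auto
  have AB: "A * B \<in> carrier_mat n n" "B * A \<in> carrier_mat m m" using A B by auto
  have Y: "det ?Y = 1"
    using A by (subst det_four_block_mat_lower_left_zero[of _ n _ m]) auto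
  have "?X * ?Y = four_block_mat (1\<^sub>m n) (0\<^sub>m n m) B (1\<^sub>m m + B * A)"
    using A B AB
    by (subst mult_four_block_mat[of _ n n _ m _ m _ _ n _ m])
      (auto intro!: arg_cong2[where f = "\<lambda>x y. four_block_mat (1\<^sub>m n) x B y"] simp: comm_add_mat[of _ m m])
  moreover have "det \<dots> = det (1\<^sub>m m + B * A)"
    using A B AB by (subst det_four_block_mat_upper_right_zero[of _ n _ m]) auto
  ultimately have 1: "det ?X = det (1\<^sub>m m + B * A)"
    using c Y by (metis det_mult mult.right_neutral)
  have "?Y * ?X = four_block_mat (1\<^sub>m n + A * B) (0\<^sub>m n m) B (1\<^sub>m m)"
    using A B AB
    by (subst mult_four_block_mat[of _ n n _ m _ m _ _ n _ m])
      (auto intro!: arg_cong2[where f = "\<lambda>x y. four_block_mat x y B (1\<^sub>m m)"])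
  moreover have "det \<dots> = det (1\<^sub>m n + A * B)"
    using A B AB by (subst det_four_block_mat_upper_right_zero[of _ n _ m]) auto
  ultimately have 2: "det ?X = det (1\<^sub>m n + A * B)"
    using c Y by (metis det_mult mult.left_neutral)
  from 1 2 show ?thesis by simp
qed

subsection \<open>Gram determinants\<close>

definition rgram :: "nat \<Rightarrow> nat \<Rightarrow> (nat \<Rightarrow> nat \<Rightarrow> real) \<Rightarrow> real" where
  "rgram n M B = ldet {..<n} (\<lambda>i k. \<Sum>j<M. B i j * B k j)"

definition cgram :: "nat \<Rightarrow> nat \<Rightarrow> (nat \<Rightarrow> nat \<Rightarrow> complex) \<Rightarrow> complex" where
  "cgram n M B = ldet {..<n} (\<lambda>i k. \<Sum>j<M. B i j * cnj (B k j))"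

lemma rgram_cong: "(\<And>i j. i < n \<Longrightarrow> j < M \<Longrightarrow> B i j = B' i j) \<Longrightarrow> rgram n M B = rgram n M B'"
  unfolding rgram_def by (intro ldet_cong sum.cong) auto

lemma cgram_cong: "(\<And>i j. i < n \<Longrightarrow> j < M \<Longrightarrow> B i j = B' i j) \<Longrightarrow> cgram n M B = cgram n M B'"
  unfolding cgram_def by (intro ldet_cong sum.cong) auto

text \<open>The Gram matrix \<open>K\<close> is replaced by \<open>U\<close> times \<open>K\<close>
  times the transpose of \<open>U\<close>, and the determinants of the outer factors have product
  1.\<close>

lemma cgram_orthogonal:
  assumes U: "\<And>i k. i < n \<Longrightarrow> k < n \<Longrightarrow> (\<Sum>l<n. U i l * U k l :: real) = (if i = k then 1 else 0)"
  shows "cgram n M (\<lambda>i j. \<Sum>l<n. of_real (U i l) * B l j) = cgram n M B"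
proof -
  define K where "K i k = (\<Sum>j<M. B i j * cnj (B k j))" for i k
  have *: "(\<Sum>j<M. (\<Sum>l<n. of_real (U i l) * B l j) * cnj (\<Sum>l<n. of_real (U k l) * B l j))
     = (\<Sum>l<n. of_real (U i l) * (\<Sum>l'<n. K l l' * of_real (U k l')))" for i k
  proof -
    have "(\<Sum>j<M. (\<Sum>l<n. of_real (U i l) * B l j) * cnj (\<Sum>l<n. of_real (U k l) * B l j))
      = (\<Sum>j<M. \<Sum>l<n. \<Sum>l'<n. of_real (U i l) * (B l j * cnj (B l' j) * of_real (U k l')))"
      by (simp add: sum_product mult_ac)
    also have "\<dots> = (\<Sum>l<n. \<Sum>j<M. \<Sum>l'<n. of_real (U i l) * (B l j * cnj (B l' j) * of_real (U k l')))"
      by (rule sum.swap)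
    also have "\<dots> = (\<Sum>l<n. \<Sum>l'<n. \<Sum>j<M. of_real (U i l) * (B l j * cnj (B l' j) * of_real (U k l')))"
      by (intro sum.cong refl sum.swap)
    also have "\<dots> = (\<Sum>l<n. of_real (U i l) * (\<Sum>l'<n. K l l' * of_real (U k l')))"
      by (simp add: K_def sum_distrib_left sum_distrib_right)
    finally show ?thesis .
  qed
  have 1: "ldet {..<n} (\<lambda>i l. of_real (U i l) :: complex) * ldet {..<n} (\<lambda>l k. of_real (U k l)) = 1"
  proof -
    have "ldet {..<n} (\<lambda>i k. \<Sum>l<n. of_real (U i l) * of_real (U k l) :: complex)
       = ldet {..<n} (\<lambda>i k. if i = k then 1 else 0)"
      using U by (intro ldet_cong) (simp flip: of_real_mult of_real_sum)
    then show ?thesis by (simp add: ldet_mult ldet_id)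
  qed
  have "cgram n M (\<lambda>i j. \<Sum>l<n. of_real (U i l) * B l j) =
     ldet {..<n} (\<lambda>i l. of_real (U i l)) * (ldet {..<n} K * ldet {..<n} (\<lambda>l k. of_real (U k l)))"
    unfolding cgram_def * by (simp add: ldet_mult[where g = "\<lambda>l k. \<Sum>l'<n. K l l' * of_real (U k l')"]
       ldet_mult[where f = K and g = "\<lambda>l k. of_real (U k l)"])
  also have "\<dots> = ldet {..<n} K" using 1 by (simp add: mult_ac)
  finally show ?thesis by (simp add: cgram_def K_def[abs_def])
qed

lemma cgram_givens:
  assumes cs: "c\<^sup>2 + s\<^sup>2 = (1::real)" and k: "k < m"
    and B': "\<And>j. j < M \<Longrightarrow> B' k j = of_real c * B k j + of_real s * B m j"
      "\<And>j. j < M \<Longrightarrow> B' m j = - of_real s * B k j + of_real c * B m j"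
      "\<And>i j. i < m \<Longrightarrow> i \<noteq> k \<Longrightarrow> j < M \<Longrightarrow> B' i j = B i j"
  shows "cgram (Suc m) M B' = cgram (Suc m) M B"
proof -
  define U :: "nat \<Rightarrow> nat \<Rightarrow> real" where
    "U i l = (if i = k then (if l = k then c else if l = m then s else 0)
       else if i = m then (if l = k then - s else if l = m then c else 0)
       else if i = l then 1 else 0)" for i l
  \<comment> \<open>The type is kept general because the formula serves twice: with the real rows of
    \<open>U\<close>, to verify orthogonality, and with the complex matrix \<open>B\<close>.\<close>
  have row: "(\<Sum>l<Suc m. of_real (U i l) * x l) = (if i = k then of_real c * x k + of_real s * x m
       else if i = m then - of_real s * x k + of_real c * x m else x i)"
    if "i < Suc m" for i and x :: "nat \<Rightarrow> 'b::{real_algebra_1, comm_ring_1}"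
  proof (cases "i = k \<or> i = m")
    case True
    have "(\<Sum>l<Suc m. of_real (U i l) * x l) = (\<Sum>l\<in>{k, m}. of_real (U i l) * x l)"
      using True k by (intro sum.mono_neutral_right) (auto simp: U_def)
    with True k show ?thesis by (auto simp: U_def)
  next
    case False
    have "(\<Sum>l<Suc m. of_real (U i l) * x l) = (\<Sum>l\<in>{i}. of_real (U i l) * x l)"
      using False that by (intro sum.mono_neutral_right) (auto simp: U_def)
    with False show ?thesis by (auto simp: U_def)
  qed
  have "(\<Sum>l<Suc m. U i l * U i' l) = (if i = i' then 1 else 0)" if "i < Suc m" "i' < Suc m" for i i'
    using row[OF that(1), of "U i'"] k cs by (auto simp: U_def power2_eq_square)
  then have "cgram (Suc m) M (\<lambda>i j. \<Sum>l<Suc m. of_real (U i l) * B l j) = cgram (Suc m) M B"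
    by (rule cgram_orthogonal)
  moreover have "cgram (Suc m) M B' = cgram (Suc m) M (\<lambda>i j. \<Sum>l<Suc m. of_real (U i l) * B l j)"
  proof (rule cgram_cong)
    fix i j assume "i < Suc m" "j < M"
    then show "B' i j = (\<Sum>l<Suc m. of_real (U i l) * B l j)"
      using B' by (subst row) (auto simp: less_Suc_eq)
  qed
  ultimately show ?thesis by simp
qed

text \<open>The Gram determinant is a symmetric bilinear form in its last row, so the two cross terms
  of the expansion cancel.\<close>

lemma cgram_axis:
  fixes \<phi> :: "nat \<Rightarrow> nat \<Rightarrow> real"
  shows "cgram (Suc m) M (\<lambda>i j. of_real (\<phi> i j) - \<i> * of_real (if i = m then b else 0)) =
    of_real (rgram (Suc m) M \<phi> + b\<^sup>2 * rgram (Suc m) M (\<lambda>i j. if i = m then 1 else \<phi> i j))"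
proof -
  \<comment> \<open>No conjugate occurs in \<open>H\<close>, which makes it bilinear and symmetric;
    the conjugation of the last row enters through the argument \<open>y\<close>, where
    \<open>- \<i> * b\<close> becomes \<open>\<i> * b\<close>.\<close>
  define H :: "(nat \<Rightarrow> complex) \<Rightarrow> (nat \<Rightarrow> complex) \<Rightarrow> complex" where
    "H x y = ldet {..<Suc m} (\<lambda>i k. \<Sum>j<M. (if i = m then x j else of_real (\<phi> i j)) *
       (if k = m then y j else of_real (\<phi> k j)))" for x y
  have sym: "H x y = H y x" for x y
    unfolding H_def by (subst ldet_transpose[symmetric]) (simp add: mult.commute)
  have lin: "H (\<lambda>j. x j + a * x' j) y = H x y + a * H x' y" for x x' y a
  proof -
    define z where "z k j = (if k = m then y j else of_real (\<phi> k j))" for k j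
    have **: "(\<Sum>j<M. (if i = m then w j else of_real (\<phi> i j)) * z k j) =
      (if i = m then \<Sum>j<M. w j * z k j else \<Sum>j<M. of_real (\<phi> i j) * z k j)" for i k w
      by simp
    show ?thesis
      unfolding H_def z_def[symmetric] **
      by (subst ldet_row_linear[symmetric])
        (auto simp: algebra_simps sum.distrib sum_distrib_left intro!: ldet_cong)
  qed
  have lin2: "H y (\<lambda>j. x j + a * x' j) = H y x + a * H y x'" for x x' y a
    unfolding sym[of y] lin ..
  let ?p = "\<lambda>j. of_real (\<phi> m j) :: complex"
  have "cgram (Suc m) M (\<lambda>i j. of_real (\<phi> i j) - \<i> * of_real (if i = m then b else 0)) =
     H (\<lambda>j. ?p j + (- \<i> * of_real b) * 1) (\<lambda>j. ?p j + (\<i> * of_real b) * 1)"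
    unfolding cgram_def H_def by (intro ldet_cong sum.cong) auto
  also have "\<dots> = H ?p ?p + (of_real b)\<^sup>2 * H (\<lambda>_. 1) (\<lambda>_. 1)"
    unfolding lin lin2 sym[of "\<lambda>_. 1" ?p] by (simp add: algebra_simps power2_eq_square)
  also have "H ?p ?p = of_real (rgram (Suc m) M \<phi>)"
    unfolding rgram_def ldet_of_real[symmetric] H_def
    by (intro ldet_cong) (auto intro!: sum.cong)
  also have "H (\<lambda>_. 1) (\<lambda>_. 1) = of_real (rgram (Suc m) M (\<lambda>i j. if i = m then 1 else \<phi> i j))"
    unfolding rgram_def ldet_of_real[symmetric] H_def
    by (intro ldet_cong) (auto intro!: sum.cong)
  finally show ?thesis by simp
qed

text \<open>Rotating two columns of a matrix leaves every entry of its row Gram matrix unchanged, as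
  inner products are rotation invariant.\<close>

lemma sum_mult_givens:
  fixes x y :: "nat \<Rightarrow> real"
  assumes cs: "c\<^sup>2 + s\<^sup>2 = 1" and k: "k < m"
    and x': "x' k = c * x k + s * x m" "x' m = - s * x k + c * x m"
      "\<And>j. j < Suc m \<Longrightarrow> j \<noteq> k \<Longrightarrow> j \<noteq> m \<Longrightarrow> x' j = x j"
    and y': "y' k = c * y k + s * y m" "y' m = - s * y k + c * y m"
      "\<And>j. j < Suc m \<Longrightarrow> j \<noteq> k \<Longrightarrow> j \<noteq> m \<Longrightarrow> y' j = y j"
  shows "(\<Sum>j<Suc m. x' j * y' j) = (\<Sum>j<Suc m. x j * y j)"
proof -
  have split: "(\<Sum>j<Suc m. w j * z j) = (w k * z k + w m * z m) + (\<Sum>j\<in>{..<Suc m} - {k, m}. w j * z j)"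
    for w z :: "nat \<Rightarrow> real"
    using k by (subst sum.subset_diff[of "{k, m}"]) auto
  have "x' k * y' k + x' m * y' m = (c\<^sup>2 + s\<^sup>2) * (x k * y k + x m * y m)"
    unfolding x' y' by (simp add: algebra_simps power2_eq_square)
  then show ?thesis
    unfolding split cs using x' y' by simp
qed

text \<open>The last row lies on the last axis, so one step of elimination removes the last column
  from the other rows. The Gram matrix factors accordingly as \<open>f\<close> times
  \<open>g\<close>.\<close>

lemma rgram_axis:
  fixes \<phi> :: "nat \<Rightarrow> nat \<Rightarrow> real"
  shows "rgram (Suc n) (Suc M) (\<lambda>i j. if i = n then (if j = M then b else 0) else \<phi> i j) = b\<^sup>2 * rgram n M \<phi>"
proof -
  let ?B = "\<lambda>i j. if i = n then (if j = M then b else 0) else \<phi> i j"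
  \<comment> \<open>Row \<open>n\<close> of \<open>f\<close> and column \<open>n\<close> of
    \<open>g\<close> vanish except for the corner \<open>b\<close>. The rest of \<open>f\<close> is
    the Gram matrix without column \<open>M\<close>, up to its column \<open>n\<close>, and the rest
    of \<open>g\<close> is the identity, up to its row \<open>n\<close>.\<close>
  define f where "f i l = (if l = n then (if i = n then b else \<phi> i M)
     else if i = n then 0 else (\<Sum>j<M. \<phi> i j * \<phi> l j))" for i l
  define g where "g l k = (if l = n then (if k = n then b else \<phi> k M)
     else if l = k then 1 else 0)" for l k
  have "rgram (Suc n) (Suc M) ?B = ldet {..<Suc n} (\<lambda>i k. \<Sum>l<Suc n. f i l * g l k)"
    unfolding rgram_def
  proof (rule ldet_cong)
    fix i k assume ik: "i \<in> {..<Suc n}" "k \<in> {..<Suc n}"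
    have "(\<Sum>l<n. f i l * g l k) = (if k = n then 0 else f i k)"
    proof (cases "k = n")
      case False
      have "(\<Sum>l<n. f i l * g l k) = (\<Sum>l<n. if l = k then f i l else 0)"
        using False by (intro sum.cong) (auto simp: g_def)
      with False ik show ?thesis by (simp add: sum.delta)
    qed (auto simp: g_def)
    then show "(\<Sum>j<Suc M. ?B i j * ?B k j) = (\<Sum>l<Suc n. f i l * g l k)"
      using ik by (auto simp: f_def g_def)
  qed
  also have "\<dots> = ldet {..<Suc n} f * ldet {..<Suc n} g"
    by (rule ldet_mult)
  also have "ldet {..<Suc n} f = b * ldet {..<n} f"
    unfolding lessThan_Suc by (subst ldet_insert_zero_row) (auto simp: f_def)
  also have "ldet {..<n} f = rgram n M \<phi>"
    unfolding rgram_def by (rule ldet_cong) (auto simp: f_def)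
  also have "ldet {..<Suc n} g = ldet {..<Suc n} (\<lambda>i j. g j i)"
    by (rule ldet_transpose[symmetric])
  also have "\<dots> = b * ldet {..<n} (\<lambda>i j. g j i)"
    unfolding lessThan_Suc by (subst ldet_insert_zero_row) (auto simp: g_def)
  also have "ldet {..<n} (\<lambda>i j. g j i) = ldet {..<n} (\<lambda>i j. if i = j then 1 else 0)"
    by (rule ldet_cong) (auto simp: g_def)
  finally show ?thesis by (simp add: ldet_id power2_eq_square)
qed

subsection \<open>Geometric means of Gaussian Gram determinants\<close>

text \<open>The factors are independent with equal laws, so every injective selection of coordinates
  is again Gaussian; this covers submatrices, choices of rows and transposition.\<close>

lemma gaussP_reindex:
  assumes "s2 > 0" "inj_on f I" "f \<in> I \<rightarrow> K"
  shows "(\<lambda>\<omega>. \<lambda>i\<in>I. \<omega> (f i)) \<in> measurable (gaussP K s2) (gaussP I s2)"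
    and "distr (gaussP K s2) (gaussP I s2) (\<lambda>\<omega>. \<lambda>i\<in>I. \<omega> (f i)) = gaussP I s2"
proof -
  show "(\<lambda>\<omega>. \<lambda>i\<in>I. \<omega> (f i)) \<in> measurable (gaussP K s2) (gaussP I s2)"
    using assms(3) by (intro measurable_restrict measurable_component_singleton) auto
  show "distr (gaussP K s2) (gaussP I s2) (\<lambda>\<omega>. \<lambda>i\<in>I. \<omega> (f i)) = gaussP I s2"
    using distr_PiM_reindex[of K "\<lambda>_. gauss s2" f I] assms prob_space_gauss by auto
qed

lemma rgram_measurable:
  assumes "\<And>i j. i < n \<Longrightarrow> j < M \<Longrightarrow> (\<lambda>\<phi>. B \<phi> i j) \<in> borel_measurable N"
  shows "(\<lambda>\<phi>. rgram n M (B \<phi>)) \<in> borel_measurable N"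
  unfolding rgram_def ldet_def
proof (intro borel_measurable_sum borel_measurable_times borel_measurable_const borel_measurable_prod assms)
  fix p i assume "p \<in> {p. p permutes {..<n}}" "i \<in> {..<n}"
  then show "p i < n" using permutes_in_image[of p "{..<n}" i] by auto
qed auto

abbreviation mat_ix :: "nat \<Rightarrow> nat \<Rightarrow> (nat \<times> nat) set" where
  "mat_ix n M \<equiv> {..<n} \<times> {..<M}"

text \<open>The coordinates outside \<open>I\<close> do not influence \<open>f\<close> and integrate
  to 1.\<close>

lemma nn_integral_gaussP_restrict:
  assumes "s2 > 0" "I \<subseteq> K" "f \<in> borel_measurable (gaussP I s2)"
    and cong: "\<And>\<phi>. f (restrict \<phi> I) = f \<phi>"
  shows "(\<integral>\<^sup>+\<phi>. f \<phi> \<partial>gaussP K s2) = (\<integral>\<^sup>+\<phi>. f \<phi> \<partial>gaussP I s2)"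
proof -
  have i: "inj_on (\<lambda>i. i) I" "(\<lambda>i. i) \<in> I \<rightarrow> K" using assms(2) by auto
  show ?thesis
    using nn_integral_distr[OF gaussP_reindex(1)[OF assms(1) i], of f] assms(3)
    by (simp add: gaussP_reindex(2)[OF assms(1) i] cong)
qed

text \<open>With the last row fixed, a rotation of the columns moves it onto the last axis. Then
  \<open>rgram_axis\<close> splits off its squared norm, and the other rows lose one column but keep
  their law.\<close>

lemma nn_integral_npow_rgram_border:
  assumes s2: "s2 > 0"
  shows "(\<integral>\<^sup>+\<phi>. npow t (rgram (Suc n) (Suc M) (\<lambda>i j. if i = n then v j else \<phi> (i, j))) \<partial>gaussP (mat_ix n (Suc M)) s2)
    = npow t (\<Sum>j<Suc M. (v j)\<^sup>2) * (\<integral>\<^sup>+\<phi>. npow t (rgram n M (\<lambda>i j. \<phi> (i, j))) \<partial>gaussP (mat_ix n M) s2)"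
proof -
  define F :: "(nat \<Rightarrow> real) \<Rightarrow> (nat \<times> nat \<Rightarrow> real) \<Rightarrow> real" where
    "F u \<phi> = rgram (Suc n) (Suc M) (\<lambda>i j. if i = n then u j else \<phi> (i, j))" for u \<phi>
  \<comment> \<open>The rotation requires a vector that vanishes beyond index \<open>M\<close>;
    \<open>F\<close> reads only the entries up to there.\<close>
  define w where "w j = (if j \<le> M then v j else 0)" for j
  let ?I = "mat_ix n (Suc M)"
  have vw: "F v \<phi> = F w \<phi>" for \<phi>
    unfolding F_def by (rule rgram_cong) (auto simp: w_def)
  have "\<exists>T b. meas_pres (gaussP ?I s2) T \<and> b\<^sup>2 = (\<Sum>i\<le>M. (w i)\<^sup>2) \<and>
    (\<forall>\<phi>. F w \<phi> = F (\<lambda>i. if i = M then b else 0) (T \<phi>))"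
  proof (rule ex_rotate_to_axis[where e = "\<lambda>a k. (a, k)" and n = n])
    show "F (givens c s k M u) \<phi>' = F u \<phi>"
      if cs: "c\<^sup>2 + s\<^sup>2 = 1" and k: "k < M" and sl: "slice_rot (\<lambda>a k. (a, k)) n (Suc M) c s k M \<phi> \<phi>'"
      for u c s k \<phi> \<phi>'
      unfolding F_def rgram_def
    proof (rule ldet_cong)
      fix i i' assume "i \<in> {..<Suc n}" "i' \<in> {..<Suc n}"
      then show "(\<Sum>j<Suc M. (if i = n then givens c s k M u j else \<phi>' (i, j)) * (if i' = n then givens c s k M u j else \<phi>' (i', j)))
        = (\<Sum>j<Suc M. (if i = n then u j else \<phi> (i, j)) * (if i' = n then u j else \<phi> (i', j)))"
        using sl k by (intro sum_mult_givens[OF cs k]) (auto simp: slice_rot_def givens_def less_Suc_eq)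
    qed
  qed (auto simp: s2 w_def)
  then obtain T b where T: "meas_pres (gaussP ?I s2) T" "b\<^sup>2 = (\<Sum>i\<le>M. (w i)\<^sup>2)"
    "\<And>\<phi>. F w \<phi> = F (\<lambda>i. if i = M then b else 0) (T \<phi>)" by auto
  have m: "(\<lambda>\<phi>. npow t (rgram n M (\<lambda>i j. \<phi> (i, j)))) \<in> borel_measurable (gaussP J s2)"
    if "mat_ix n M \<subseteq> J" for J
    using that by (intro measurable_compose[OF rgram_measurable npow_measurable] gauss_component) auto
  have [measurable]: "(\<lambda>\<phi>. npow t (rgram n M (\<lambda>i j. \<phi> (i, j)))) \<in> borel_measurable (gaussP ?I s2)"
    by (rule m) auto
  have "(\<integral>\<^sup>+\<phi>. npow t (F v \<phi>) \<partial>gaussP ?I s2) = (\<integral>\<^sup>+\<phi>. npow t (b\<^sup>2 * rgram n M (\<lambda>i j. T \<phi> (i, j))) \<partial>gaussP ?I s2)"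
    unfolding vw T(3) by (simp add: F_def rgram_axis)
  also have "\<dots> = (\<integral>\<^sup>+\<phi>. npow t (b\<^sup>2) * npow t (rgram n M (\<lambda>i j. T \<phi> (i, j))) \<partial>gaussP ?I s2)"
    by (simp add: npow_mult)
  also have "\<dots> = (\<integral>\<^sup>+\<phi>. npow t (b\<^sup>2) * npow t (rgram n M (\<lambda>i j. \<phi> (i, j))) \<partial>distr (gaussP ?I s2) (gaussP ?I s2) T)"
    using T(1) by (subst nn_integral_distr) (auto simp: meas_pres_def)
  also have "distr (gaussP ?I s2) (gaussP ?I s2) T = gaussP ?I s2"
    using T(1) by (simp add: meas_pres_def)
  also have "(\<integral>\<^sup>+\<phi>. npow t (b\<^sup>2) * npow t (rgram n M (\<lambda>i j. \<phi> (i, j))) \<partial>gaussP ?I s2)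
      = npow t (b\<^sup>2) * (\<integral>\<^sup>+\<phi>. npow t (rgram n M (\<lambda>i j. \<phi> (i, j))) \<partial>gaussP ?I s2)"
    by (intro nn_integral_cmult) measurable
  also have "(\<integral>\<^sup>+\<phi>. npow t (rgram n M (\<lambda>i j. \<phi> (i, j))) \<partial>gaussP ?I s2)
      = (\<integral>\<^sup>+\<phi>. npow t (rgram n M (\<lambda>i j. \<phi> (i, j))) \<partial>gaussP (mat_ix n M) s2)"
    using m[of "mat_ix n M"]
    by (intro nn_integral_gaussP_restrict s2) (auto intro!: arg_cong[where f = "npow t"] rgram_cong)
  also have "b\<^sup>2 = (\<Sum>j<Suc M. (v j)\<^sup>2)"
    unfolding T(2) lessThan_Suc_atMost by (intro sum.cong) (auto simp: w_def)
  finally show ?thesis by (simp add: F_def)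
qed

text \<open>The last row is integrated last: given its value, the other rows contribute the moment
  for one row and one column less. Hence the factors have dimensions \<open>M\<close>,
  \<open>M - 1\<close> and so on, as for independent squared norms. All are at least 1, whence
  \<open>2 * t < 1\<close>.\<close>

lemma nn_integral_npow_rgram:
  assumes s2: "s2 > 0" and t: "0 < t" "2 * t < 1"
  shows "n \<le> M \<Longrightarrow> (\<integral>\<^sup>+\<phi>. npow t (rgram n M (\<lambda>i j. \<phi> (i, j))) \<partial>gaussP (mat_ix n M) s2)
    = ennreal (\<Prod>i<n. chi_nmom s2 t (M - i))"
proof (induction n arbitrary: M)
  case 0
  interpret prob_space "gaussP {} s2 :: (nat \<times> nat \<Rightarrow> real) measure" by (rule prob_space_gaussP[OF s2])
  show ?case by (simp add: rgram_def npow_def emeasure_space_1)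
next
  case (Suc n)
  then obtain M' where M: "M = Suc M'" "n \<le> M'" by (cases M) auto
  interpret product_sigma_finite "\<lambda>_ :: nat \<times> nat. gauss s2" by (rule product_sigma_finite_gauss[OF s2])
  let ?I = "{n} \<times> {..<Suc M'}" and ?J = "mat_ix n (Suc M')"
  have IJ: "mat_ix (Suc n) (Suc M') = ?I \<union> ?J" by auto
  let ?E = "\<integral>\<^sup>+\<phi>. npow t (rgram n M' (\<lambda>i j. \<phi> (i, j))) \<partial>gaussP (mat_ix n M') s2"
  have "(\<integral>\<^sup>+\<phi>. npow t (rgram (Suc n) (Suc M') (\<lambda>i j. \<phi> (i, j))) \<partial>gaussP (mat_ix (Suc n) (Suc M')) s2)
    = (\<integral>\<^sup>+x. (\<integral>\<^sup>+y. npow t (rgram (Suc n) (Suc M') (\<lambda>i j. merge ?I ?J (x, y) (i, j))) \<partial>gaussP ?J s2) \<partial>gaussP ?I s2)"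
    unfolding IJ
    by (intro product_nn_integral_fold measurable_compose[OF rgram_measurable npow_measurable] gauss_component)
      auto
  also have "\<dots> = (\<integral>\<^sup>+x. npow t (\<Sum>j<Suc M'. (x (n, j))\<^sup>2) * ?E \<partial>gaussP ?I s2)"
  proof (rule nn_integral_cong)
    fix x
    have "rgram (Suc n) (Suc M') (\<lambda>i j. merge ?I ?J (x, y) (i, j)) =
      rgram (Suc n) (Suc M') (\<lambda>i j. if i = n then x (n, j) else y (i, j))" for y
      by (rule rgram_cong) (auto simp: merge_def)
    then show "(\<integral>\<^sup>+y. npow t (rgram (Suc n) (Suc M') (\<lambda>i j. merge ?I ?J (x, y) (i, j))) \<partial>gaussP ?J s2)
      = npow t (\<Sum>j<Suc M'. (x (n, j))\<^sup>2) * ?E"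
      by (simp only: nn_integral_npow_rgram_border[OF s2])
  qed
  also have "\<dots> = (\<integral>\<^sup>+x. npow t (\<Sum>p\<in>?I. (x p)\<^sup>2) * ?E \<partial>gaussP ?I s2)"
  proof -
    have "(\<Sum>j<Suc M'. (x (n, j))\<^sup>2) = (\<Sum>p\<in>?I. (x p)\<^sup>2)" for x :: "nat \<times> nat \<Rightarrow> real"
      by (rule sum.reindex_bij_witness[of _ snd "Pair n"]) auto
    then show ?thesis by presburger
  qed
  also have "\<dots> = (\<integral>\<^sup>+x. npow t (\<Sum>p\<in>?I. (x p)\<^sup>2) \<partial>gaussP ?I s2) * ?E"
    by (intro nn_integral_multc) measurable
  also have "(\<integral>\<^sup>+x. npow t (\<Sum>p\<in>?I. (x p)\<^sup>2) \<partial>gaussP ?I s2) = ennreal (chi_nmom s2 t (card ?I))"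
    using s2 t by (intro nn_integral_npow_norm2) auto
  also have "?E = ennreal (\<Prod>i<n. chi_nmom s2 t (M' - i))"
    by (rule Suc.IH[OF M(2)])
  also have "ennreal (chi_nmom s2 t (card ?I)) * \<dots> = ennreal (\<Prod>i<Suc n. chi_nmom s2 t (M - i))"
    using t chi_nmom_pos[OF s2 t(1), of "Suc M'"]
    by (subst ennreal_mult'[symmetric]) (auto simp: M prod.lessThan_Suc_shift simp del: prod.lessThan_Suc)
  finally show ?case by (simp add: M)
qed

text \<open>The number whose power \<open>- t\<close> is the negative moment of the Gram determinant
  of an \<open>n\<close> by \<open>M\<close> Gaussian matrix.\<close>

definition gmom :: "real \<Rightarrow> real \<Rightarrow> nat \<Rightarrow> nat \<Rightarrow> real" where
  "gmom s2 t n M = (\<Prod>i<n. chi_nmom s2 t (M - i) powr (- 1 / t))"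

lemma gmom_powr:
  assumes "s2 > 0" "0 < t" "2 * t < 1" "n \<le> M"
  shows "gmom s2 t n M > 0" "gmom s2 t n M powr - t = (\<Prod>i<n. chi_nmom s2 t (M - i))"
proof -
  have pos: "chi_nmom s2 t (M - i) > 0" if "i < n" for i
    using assms that by (intro chi_nmom_pos) auto
  then show "gmom s2 t n M > 0"
    unfolding gmom_def by (intro prod_pos) (auto simp: less_imp_neq[THEN not_sym])
  have "gmom s2 t n M powr - t = (\<Prod>i<n. (chi_nmom s2 t (M - i) powr (- 1 / t)) powr - t)"
    unfolding gmom_def by (rule prod_powr_distrib)
  also have "\<dots> = (\<Prod>i<n. chi_nmom s2 t (M - i))"
    using pos assms(2) by (intro prod.cong) (auto simp: powr_powr less_imp_le)
  finally show "gmom s2 t n M powr - t = (\<Prod>i<n. chi_nmom s2 t (M - i))" .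
qed

lemma gmean_rgram:
  assumes "s2 > 0" "0 < t" "2 * t < 1" "n \<le> M"
  shows "gmean_ge (gaussP (mat_ix n M) s2) (\<lambda>\<phi>. rgram n M (\<lambda>i j. \<phi> (i, j))) (gmom s2 t n M)"
  using assms
  by (intro gmean_ge_npow[of _ t] prob_space_gaussP gmom_powr rgram_measurable gauss_component)
    (auto simp: nn_integral_npow_rgram gmom_powr)

text \<open>The row of ones has squared norm \<open>Suc M\<close>, and after splitting it off an
  \<open>n\<close> by \<open>M\<close> Gaussian Gram determinant remains.\<close>

lemma gmean_rgram_ones:
  assumes s2: "s2 > 0" and t: "0 < t" "2 * t < 1" and nM: "n \<le> M"
  shows "gmean_ge (gaussP (mat_ix (Suc n) (Suc M)) s2)
    (\<lambda>\<phi>. rgram (Suc n) (Suc M) (\<lambda>i j. if i = n then 1 else \<phi> (i, j))) (real (Suc M) * gmom s2 t n M)"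
proof (rule gmean_ge_npow[of _ t])
  show "prob_space (gaussP (mat_ix (Suc n) (Suc M)) s2)" by (rule prob_space_gaussP[OF s2])
  show "0 < real (Suc M) * gmom s2 t n M" using gmom_powr[OF s2 t nM] by simp
  have m: "(\<lambda>\<phi>. rgram (Suc n) (Suc M) (\<lambda>i j. if i = n then 1 else \<phi> (i, j))) \<in> borel_measurable (gaussP J s2)"
    if "mat_ix n (Suc M) \<subseteq> J" for J
  proof (rule rgram_measurable)
    fix i j assume "i < Suc n" "j < Suc M"
    then show "(\<lambda>\<phi>. if i = n then 1 else \<phi> (i, j)) \<in> borel_measurable (gaussP J s2)"
      using that by (cases "i = n") (auto intro!: gauss_component)
  qed
  show "(\<lambda>\<phi>. rgram (Suc n) (Suc M) (\<lambda>i j. if i = n then 1 else \<phi> (i, j)))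
     \<in> borel_measurable (gaussP (mat_ix (Suc n) (Suc M)) s2)"
    by (rule m) auto
  have "(\<integral>\<^sup>+\<phi>. npow t (rgram (Suc n) (Suc M) (\<lambda>i j. if i = n then 1 else \<phi> (i, j))) \<partial>gaussP (mat_ix (Suc n) (Suc M)) s2)
    = (\<integral>\<^sup>+\<phi>. npow t (rgram (Suc n) (Suc M) (\<lambda>i j. if i = n then 1 else \<phi> (i, j))) \<partial>gaussP (mat_ix n (Suc M)) s2)"
    using m[of "mat_ix n (Suc M)"]
    by (intro nn_integral_gaussP_restrict s2) (auto intro!: arg_cong[where f = "npow t"] rgram_cong)
  also have "\<dots> = npow t (\<Sum>j<Suc M. 1\<^sup>2) * ennreal (\<Prod>i<n. chi_nmom s2 t (M - i))"
    unfolding nn_integral_npow_rgram_border[OF s2, where v = "\<lambda>_. 1"] nn_integral_npow_rgram[OF s2 t nM] ..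
  also have "\<dots> = ennreal ((real (Suc M) * gmom s2 t n M) powr - t)"
    using gmom_powr[OF s2 t nM] by (simp add: npow_def powr_mult ennreal_mult')
  finally show "(\<integral>\<^sup>+\<phi>. npow t (rgram (Suc n) (Suc M) (\<lambda>i j. if i = n then 1 else \<phi> (i, j))) \<partial>gaussP (mat_ix (Suc n) (Suc M)) s2)
    = ennreal ((real (Suc M) * gmom s2 t n M) powr - t)" .
qed (use t in auto)

text \<open>The factor \<open>n\<close> is the squared length of the imaginary part gathered into
  one row, and \<open>M\<close> is the squared norm of a row of ones. The value 1 at
  \<open>n = 0\<close> belongs to the empty minor.\<close>

definition minor_gmean :: "real \<Rightarrow> real \<Rightarrow> nat \<Rightarrow> nat \<Rightarrow> real" where
  "minor_gmean s2 t n M = (if n = 0 then 1 else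
     gmom s2 t n M + real n * (real M * gmom s2 t (n - 1) (M - 1)))"

text \<open>The imaginary parts of the rows form the vector \<open>- 1\<close> in dimension
  \<open>n\<close>. Rotating the rows concentrates it in row \<open>m\<close> with
  \<open>b\<^sup>2 = n\<close>; then \<open>cgram_axis\<close> applies, and superadditivity treats
  the two summands separately.\<close>

lemma gmean_cgram:
  assumes s2: "s2 > 0" and t: "0 < t" "2 * t < 1" and nM: "n \<le> M" "n > 0"
  shows "gmean_ge (gaussP (mat_ix n M) s2)
    (\<lambda>\<phi>. Re (cgram n M (\<lambda>i j. of_real (\<phi> (i, j)) - \<i>))) (minor_gmean s2 t n M)"
proof -
  obtain m M' where m: "n = Suc m" "M = Suc M'" "m \<le> M'" using nM by (cases n; cases M) auto
  define F :: "(nat \<Rightarrow> real) \<Rightarrow> (nat \<times> nat \<Rightarrow> real) \<Rightarrow> complex" where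
    "F u \<phi> = cgram n M (\<lambda>i j. of_real (\<phi> (i, j)) - \<i> * of_real (u i))" for u \<phi>
  define w :: "nat \<Rightarrow> real" where "w i = (if i \<le> m then 1 else 0)" for i
  let ?P = "gaussP (mat_ix n M) s2"
  have "\<exists>T b. meas_pres ?P T \<and> b\<^sup>2 = (\<Sum>i\<le>m. (w i)\<^sup>2) \<and>
    (\<forall>\<phi>. F w \<phi> = F (\<lambda>i. if i = m then b else 0) (T \<phi>))"
  \<comment> \<open>The coordinates are swapped against the earlier use: here rows are combined,
    within each of the \<open>M\<close> columns.\<close>
  proof (rule ex_rotate_to_axis[where e = "\<lambda>a k. (k, a)" and n = M])
    show "F (givens c s k m u) \<phi>' = F u \<phi>"
      if cs: "c\<^sup>2 + s\<^sup>2 = 1" and k: "k < m" and sl: "slice_rot (\<lambda>a k. (k, a)) M (Suc m) c s k m \<phi> \<phi>'"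
      for u c s k \<phi> \<phi>'
      unfolding F_def m(1)
    proof (rule cgram_givens[OF cs k])
      fix i j assume j: "j < M"
      have p: "\<phi>' (k, j) = c * \<phi> (k, j) + s * \<phi> (m, j)" "\<phi>' (m, j) = - s * \<phi> (k, j) + c * \<phi> (m, j)"
        using sl j by (simp_all add: slice_rot_def)
      show "of_real (\<phi>' (k, j)) - \<i> * of_real (givens c s k m u k) =
          of_real c * (of_real (\<phi> (k, j)) - \<i> * of_real (u k)) + of_real s * (of_real (\<phi> (m, j)) - \<i> * of_real (u m))"
        unfolding p using k by (simp add: givens_def algebra_simps)
      show "of_real (\<phi>' (m, j)) - \<i> * of_real (givens c s k m u m) =
          - of_real s * (of_real (\<phi> (k, j)) - \<i> * of_real (u k)) + of_real c * (of_real (\<phi> (m, j)) - \<i> * of_real (u m))"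
        unfolding p using k by (simp add: givens_def algebra_simps)
      assume "i < m" "i \<noteq> k"
      then show "of_real (\<phi>' (i, j)) - \<i> * of_real (givens c s k m u i) = of_real (\<phi> (i, j)) - \<i> * of_real (u i)"
        using sl j by (simp add: slice_rot_def givens_def)
    qed
  qed (auto simp: s2 w_def m)
  then obtain T b where T: "meas_pres ?P T" "b\<^sup>2 = (\<Sum>i\<le>m. (w i)\<^sup>2)"
    "\<And>\<phi>. F w \<phi> = F (\<lambda>i. if i = m then b else 0) (T \<phi>)" by auto
  have b: "b\<^sup>2 = real n" unfolding T(2) by (simp add: w_def m)
  define R where "R \<phi> = rgram n M (\<lambda>i j. \<phi> (i, j)) +
      real n * rgram n M (\<lambda>i j. if i = m then 1 else \<phi> (i, j))" for \<phi> :: "nat \<times> nat \<Rightarrow> real"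
  have eq: "Re (cgram n M (\<lambda>i j. of_real (\<phi> (i, j)) - \<i>)) = R (T \<phi>)" for \<phi>
  proof -
    have "cgram n M (\<lambda>i j. of_real (\<phi> (i, j)) - \<i>) = F w \<phi>"
      unfolding F_def by (rule cgram_cong) (auto simp: w_def m)
    also have "\<dots> = of_real (R (T \<phi>))"
      unfolding T(3) by (simp only: F_def R_def m(1) cgram_axis b[unfolded m(1)])
    finally show ?thesis by simp
  qed
  have "gmean_ge ?P R (gmom s2 t n M + real n * (real M * gmom s2 t m M'))"
    unfolding R_def
    using gmean_rgram[OF s2 t nM(1)] gmean_rgram_ones[OF s2 t m(3)] nM(2)
    by (intro gmean_ge_add gmean_ge_cmult prob_space_gaussP s2) (auto simp: m)
  from gmean_ge_distr[OF _ _ this, of T ?P] T(1) show ?thesis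
    unfolding eq using m by (simp add: meas_pres_def minor_gmean_def)
qed

text \<open>The second product has dimensions \<open>M - 1 - i\<close>, so its limits are the
  factors \<open>1\<close> to \<open>n - 1\<close> of the first. Both summands thus share all
  factors but the one at \<open>i = 0\<close>, which becomes \<open>n * M\<close> plus the digamma
  term.\<close>

lemma minor_gmean_tendsto:
  assumes "s2 > 0" "0 < n" "n \<le> M"
  shows "((\<lambda>t. minor_gmean s2 t n M) \<longlongrightarrow>
    (\<Prod>i<n. (if i = 0 then 1 else 0) * real n * real M + 2 * s2 * exp (Digamma ((real M - real i) / 2)))) (at_right 0)"
proof -
  define a where "a i = 2 * s2 * exp (Digamma ((real M - real i) / 2))" for i
  have lim: "((\<lambda>t. chi_nmom s2 t (M - i) powr (- 1 / t)) \<longlongrightarrow> a i) (at_right 0)" if "i < n" for i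
    using chi_nmom_tendsto[OF assms(1), of "M - i"] that assms by (simp add: a_def of_nat_diff)
  obtain m M' where m: "n = Suc m" "M = Suc M'" using assms by (cases n; cases M) auto
  have 1: "((\<lambda>t. gmom s2 t n M) \<longlongrightarrow> (\<Prod>i<n. a i)) (at_right 0)"
    unfolding gmom_def by (intro tendsto_prod lim) auto
  have 2: "((\<lambda>t. gmom s2 t m M') \<longlongrightarrow> (\<Prod>i<m. a (Suc i))) (at_right 0)"
    unfolding gmom_def using lim[of "Suc _"] by (intro tendsto_prod) (auto simp: m)
  have "((\<lambda>t. minor_gmean s2 t n M) \<longlongrightarrow> (\<Prod>i<n. a i) + real n * (real M * (\<Prod>i<m. a (Suc i)))) (at_right 0)"
    unfolding minor_gmean_def using 1 2 by (auto simp: m simp del: of_nat_Suc intro!: tendsto_intros)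
  also have "(\<Prod>i<n. a i) + real n * (real M * (\<Prod>i<m. a (Suc i))) =
     (\<Prod>i<n. (if i = 0 then 1 else 0) * real n * real M + a i)"
    by (simp add: m prod.lessThan_Suc_shift algebra_simps del: of_nat_Suc prod.lessThan_Suc)
  finally show ?thesis by (simp add: a_def)
qed

subsection \<open>The principal minor expansion of the capacity\<close>

text \<open>In the term of each permutation the scalars multiply to the product of all
  \<open>a i * b i\<close>, which is 1.\<close>

lemma ldet_diag_conj:
  assumes "finite S" and a: "\<And>i. i \<in> S \<Longrightarrow> a i * b i = 1"
  shows "ldet S (\<lambda>i k. a i * b k * K i k) = ldet S K"
proof -
  have "(\<Prod>i\<in>S. a i * b (p i) * K i (p i)) = (\<Prod>i\<in>S. K i (p i))" if p: "p permutes S" for p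
  proof -
    have "(\<Prod>i\<in>S. a i * b (p i) * K i (p i)) = (\<Prod>i\<in>S. a i) * (\<Prod>i\<in>S. b (p i)) * (\<Prod>i\<in>S. K i (p i))"
      by (simp add: prod.distrib)
    also have "(\<Prod>i\<in>S. b (p i)) = (\<Prod>i\<in>S. b i)"
      using prod.permute[OF p, of b] by (simp add: comp_def)
    also have "(\<Prod>i\<in>S. a i) * (\<Prod>i\<in>S. b i) = 1"
      using a by (simp add: prod.distrib[symmetric])
    finally show ?thesis by simp
  qed
  then show ?thesis unfolding ldet_def by (intro sum.cong) auto
qed

lemma sum_Pow_card:
  fixes f :: "nat \<Rightarrow> real"
  shows "(\<Sum>S\<in>Pow {..<m}. f (card S)) = (\<Sum>n\<le>m. real (m choose n) * f n)"
proof -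
  have "(\<Sum>S\<in>Pow {..<m}. f (card S)) = (\<Sum>n\<le>m. \<Sum>S | S \<in> Pow {..<m} \<and> card S = n. f (card S))"
    using card_mono[of "{..<m}"] by (intro sum.group[symmetric]) auto
  also have "\<dots> = (\<Sum>n\<le>m. real (m choose n) * f n)"
    using n_subsets[of "{..<m}"] by (intro sum.cong) auto
  finally show ?thesis .
qed

text \<open>Since \<open>1 + \<i> * x = \<i> * (x - \<i>)\<close>, the unit \<open>\<i>\<close> and
  the phase \<open>h j\<close> cancel against their conjugates in every entry of the product. The
  phases of \<open>g\<close> act as a diagonal conjugation and disappear from each principal
  minor.\<close>

lemma Re_det_capacity:
  assumes g: "\<forall>i<m. cmod (g i) = 1" and h: "\<forall>j<M. cmod (h j) = 1"
  shows "Re (det (1\<^sub>m m + complex_of_real c \<cdot>\<^sub>m (Hhat m M g h \<phi> * herm (Hhat m M g h \<phi>)))) =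
    (\<Sum>S\<in>Pow {..<m}. c ^ card S * Re (ldet S (\<lambda>i k. \<Sum>j<M.
       (of_real (\<phi> (i, j)) - \<i>) * cnj (of_real (\<phi> (k, j)) - \<i>))))"
proof -
  define K where "K i k = (\<Sum>j<M. (of_real (\<phi> (i, j)) - \<i>) * cnj (of_real (\<phi> (k, j)) - \<i>))" for i k
  \<comment> \<open>Continued by 1 beyond \<open>m\<close>, so that
    \<open>a i * cnj (a i) = 1\<close> holds for all \<open>i\<close>.\<close>
  define a where "a i = (if i < m then g i else 1)" for i
  have a: "a i * cnj (a i) = 1" for i
    using g by (simp add: a_def complex_norm_square[symmetric])
  let ?H = "Hhat m M g h \<phi>"
  have "1\<^sub>m m + complex_of_real c \<cdot>\<^sub>m (?H * herm ?H) =
    mat m m (\<lambda>(i, k). (if i = k then 1 else 0) + of_real c * (a i * cnj (a k) * K i k))"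
  proof (rule eq_matI)
    fix i k assume "i < dim_row (mat m m (\<lambda>(i, k). (if i = k then 1 else 0) + of_real c * (a i * cnj (a k) * K i k)))"
      "k < dim_col (mat m m (\<lambda>(i, k). (if i = k then 1 else 0) + of_real c * (a i * cnj (a k) * K i k)))"
    then have ik: "i < m" "k < m" by auto
    have "(?H * herm ?H) $$ (i, k) = (\<Sum>j<M. g i * h j * (1 + \<i> * of_real (\<phi> (i, j))) *
        cnj (g k * h j * (1 + \<i> * of_real (\<phi> (k, j)))))"
      using ik by (simp add: Hhat_def herm_def scalar_prod_def atLeast0LessThan)
    also have "\<dots> = (\<Sum>j<M. a i * cnj (a k) * ((of_real (\<phi> (i, j)) - \<i>) * cnj (of_real (\<phi> (k, j)) - \<i>)))"
    proof (intro sum.cong refl)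
      fix j assume "j \<in> {..<M}"
      then have hj: "h j * cnj (h j) = 1" using h by (simp add: complex_norm_square[symmetric])
      have "g i * h j * (1 + \<i> * of_real (\<phi> (i, j))) * cnj (g k * h j * (1 + \<i> * of_real (\<phi> (k, j)))) =
        (h j * cnj (h j)) * (g i * cnj (g k) * ((of_real (\<phi> (i, j)) - \<i>) * cnj (of_real (\<phi> (k, j)) - \<i>)))"
        by (simp add: algebra_simps)
      then show "g i * h j * (1 + \<i> * of_real (\<phi> (i, j))) * cnj (g k * h j * (1 + \<i> * of_real (\<phi> (k, j)))) =
        a i * cnj (a k) * ((of_real (\<phi> (i, j)) - \<i>) * cnj (of_real (\<phi> (k, j)) - \<i>))"
        unfolding hj using ik by (simp add: a_def)
    qed
    finally have "(?H * herm ?H) $$ (i, k) = a i * cnj (a k) * K i k"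
      by (simp add: K_def sum_distrib_left)
    then show "(1\<^sub>m m + complex_of_real c \<cdot>\<^sub>m (?H * herm ?H)) $$ (i, k) =
       mat m m (\<lambda>(i, k). (if i = k then 1 else 0) + of_real c * (a i * cnj (a k) * K i k)) $$ (i, k)"
      using ik by (simp add: Hhat_def herm_def)
  qed (auto simp: Hhat_def herm_def)
  then have "det (1\<^sub>m m + complex_of_real c \<cdot>\<^sub>m (?H * herm ?H)) =
     (\<Sum>S\<in>Pow {..<m}. of_real c ^ card S * ldet S (\<lambda>i k. a i * cnj (a k) * K i k))"
    by (simp add: det_mat_eq_ldet ldet_id_plus)
  also have "\<dots> = (\<Sum>S\<in>Pow {..<m}. of_real (c ^ card S) * ldet S K)"
    using a by (intro sum.cong refl arg_cong2[where f = "(*)"] ldet_diag_conj) (auto intro: finite_subset)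
  finally show ?thesis unfolding K_def[abs_def] by simp
qed

text \<open>The rows in \<open>S\<close> are numbered by \<open>f\<close>; the selected rows form a
  Gaussian matrix of size \<open>card S\<close> by \<open>M\<close>, whose shifted Gram determinant
  is the minor.\<close>

lemma gmean_minor:
  assumes s2: "s2 > 0" and t: "0 < t" "2 * t < 1" and mM: "m \<le> M" and S: "S \<subseteq> {..<m}"
  shows "gmean_ge (gaussP (mat_ix m M) s2) (\<lambda>\<phi>. Re (ldet S (\<lambda>i k. \<Sum>j<M.
       (of_real (\<phi> (i, j)) - \<i>) * cnj (of_real (\<phi> (k, j)) - \<i>)))) (minor_gmean s2 t (card S) M)"
proof (cases "S = {}")
  case True
  then show ?thesis
    using gmean_ge_const[OF prob_space_gaussP[OF s2], of 1 "mat_ix m M"] by (simp add: minor_gmean_def)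
next
  case False
  define n where "n = card S"
  have fin: "finite S" using S by (rule finite_subset) auto
  have n: "0 < n" "n \<le> M"
    using False fin card_mono[OF _ S] mM by (auto simp: n_def card_gt_0_iff)
  obtain f where f: "bij_betw f {..<n} S"
    using ex_bij_betw_nat_finite[OF fin] by (auto simp: n_def atLeast0LessThan)
  let ?f = "\<lambda>(i, j). (f i, j)"
  have inj: "inj_on ?f (mat_ix n M)" "?f \<in> mat_ix n M \<rightarrow> mat_ix m M"
    using f S by (auto simp: bij_betw_def inj_on_def)
  let ?T = "\<lambda>\<omega>. \<lambda>p\<in>mat_ix n M. \<omega> (?f p)"
  have "Re (cgram n M (\<lambda>i j. of_real (?T \<phi> (i, j)) - \<i>)) =
    Re (ldet S (\<lambda>i k. \<Sum>j<M. (of_real (\<phi> (i, j)) - \<i>) * cnj (of_real (\<phi> (k, j)) - \<i>)))" for \<phi>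
    unfolding ldet_reindex[OF f finite_lessThan] cgram_def
    by (intro arg_cong[where f = Re] ldet_cong sum.cong) auto
  then show ?thesis
    using gmean_ge_distr[OF gaussP_reindex[OF s2 inj] gmean_cgram[OF s2 t n(2,1)]]
    by (simp add: n_def)
qed

lemma gmean_capacity:
  assumes s2: "s2 > 0" and t: "0 < t" "2 * t < 1" and c: "c > 0" and mM: "m \<le> M"
    and g: "\<forall>i<m. cmod (g i) = 1" and h: "\<forall>j<M. cmod (h j) = 1"
  shows "gmean_ge (gaussP (mat_ix m M) s2)
    (\<lambda>\<phi>. Re (det (1\<^sub>m m + complex_of_real c \<cdot>\<^sub>m (Hhat m M g h \<phi> * herm (Hhat m M g h \<phi>)))))
    (1 + (\<Sum>n=1..m. c ^ n * real (m choose n) * minor_gmean s2 t n M))"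
proof -
  have "(\<Sum>S\<in>Pow {..<m}. c ^ card S * minor_gmean s2 t (card S) M)
    = (\<Sum>n\<le>m. real (m choose n) * (c ^ n * minor_gmean s2 t n M))"
    by (rule sum_Pow_card)
  also have "\<dots> = 1 + (\<Sum>n=1..m. real (m choose n) * (c ^ n * minor_gmean s2 t n M))"
    by (simp add: atMost_atLeast0 sum.atLeast_Suc_atMost minor_gmean_def)
  finally have eq: "(\<Sum>S\<in>Pow {..<m}. c ^ card S * minor_gmean s2 t (card S) M)
    = 1 + (\<Sum>n=1..m. c ^ n * real (m choose n) * minor_gmean s2 t n M)"
    by (simp add: mult_ac)
  show ?thesis
    unfolding Re_det_capacity[OF g h] eq[symmetric]
    using c by (intro gmean_ge_sum gmean_ge_cmult gmean_minor prob_space_gaussP s2 t mM) auto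
qed

section \<open>Passage to the limit and exchange of the two dimensions\<close>

lemma nn_integral_log_lower_bound:
  assumes s2: "s2 > 0" and c: "c > 0" and mM: "m \<le> M"
    and gm: "\<And>t. 0 < t \<Longrightarrow> 2 * t < 1 \<Longrightarrow>
      gmean_ge N f (1 + (\<Sum>n=1..m. c ^ n * real (m choose n) * minor_gmean s2 t n M))"
  shows "ennreal (log 2 (1 + (\<Sum>n=1..m. c ^ n * real (m choose n) *
      (\<Prod>i<n. (if i = 0 then 1 else 0) * real n * real M + 2 * s2 * exp (Digamma ((real M - real i) / 2))))))
    \<le> (\<integral>\<^sup>+x. ennreal (log 2 (f x)) \<partial>N)" (is "ennreal (log 2 ?q) \<le> ?C")
proof (rule tendsto_upperbound)
  \<comment> \<open>The integral does not depend on \<open>t\<close>, so the bounds for small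
    \<open>t\<close> pass to the limit at 0 from the right, where the digamma function
    appears.\<close>
  let ?Q = "\<lambda>t. 1 + (\<Sum>n=1..m. c ^ n * real (m choose n) * minor_gmean s2 t n M)"
  have "(?Q \<longlongrightarrow> ?q) (at_right 0)"
    using mM by (intro tendsto_intros minor_gmean_tendsto s2) auto
  moreover have "?q > 0"
    using c s2 by (intro add_pos_nonneg sum_nonneg mult_nonneg_nonneg prod_nonneg ballI add_nonneg_nonneg) auto
  ultimately show "((\<lambda>t. ennreal (log 2 (?Q t))) \<longlongrightarrow> ennreal (log 2 ?q)) (at_right 0)"
    by (intro tendsto_ennrealI tendsto_log) auto
  show "\<forall>\<^sub>F t in at_right 0. ennreal (log 2 (?Q t)) \<le> ?C"
    unfolding eventually_at_right_field
    by (intro exI[of _ "1/2"] conjI allI impI gmean_ge_nn_integral_log gm) auto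
qed simp

text \<open>Sylvester's identity leads to \<open>herm A * A\<close>, whose transpose is the product
  of \<open>transpose_mat A\<close> and its own \<open>herm\<close>; transposition preserves the
  determinant.\<close>

lemma det_capacity_transpose:
  assumes "A \<in> carrier_mat n m"
  shows "det (1\<^sub>m n + c \<cdot>\<^sub>m (A * herm A)) = det (1\<^sub>m m + c \<cdot>\<^sub>m (transpose_mat A * herm (transpose_mat A)))"
proof -
  have h: "herm A \<in> carrier_mat m n" using assms by (auto simp: herm_def)
  have hA: "herm A * A \<in> carrier_mat m m" using assms h by auto
  have "det (1\<^sub>m n + c \<cdot>\<^sub>m (A * herm A)) = det (1\<^sub>m n + A * (c \<cdot>\<^sub>m herm A))"
    using assms h by (simp add: mult_smult_distrib)
  also have "\<dots> = det (1\<^sub>m m + (c \<cdot>\<^sub>m herm A) * A)"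
    using assms h by (intro det_one_plus_mult_comm) auto
  also have "\<dots> = det (1\<^sub>m m + c \<cdot>\<^sub>m (herm A * A))"
    using assms h by (simp add: mult_smult_assoc_mat)
  also have "\<dots> = det (transpose_mat (1\<^sub>m m + c \<cdot>\<^sub>m (herm A * A)))"
    using hA by (intro det_transpose[of _ m, symmetric]) auto
  also have "transpose_mat (1\<^sub>m m + c \<cdot>\<^sub>m (herm A * A)) =
      1\<^sub>m m + c \<cdot>\<^sub>m (transpose_mat A * herm (transpose_mat A))"
    using assms by (intro eq_matI) (auto simp: herm_def scalar_prod_def mult.commute)
  finally show ?thesis .
qed

theorem theorem7:
  fixes MR MT :: nat and rho s2 :: real and g h :: "nat \<Rightarrow> complex"
  assumes "rho > 0" and "s2 > 0"
    and "\<forall>i<MR. cmod (g i) = 1" and "\<forall>j<MT. cmod (h j) = 1"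
  shows "(MR \<le> MT \<longrightarrow>
           ennreal (log 2 (1 + (\<Sum>n=1..MR. (rho / real MT) ^ n * real (MR choose n) *
              (\<Prod>i<n. (if i = 0 then 1 else 0) * real n * real MT
                        + 2 * s2 * exp (Digamma ((real MT - real i) / 2))))))
           \<le> Chat MR MT rho s2 g h)
       \<and> (MR > MT \<longrightarrow>
           ennreal (log 2 (1 + (\<Sum>n=1..MT. (rho / real MT) ^ n * real (MT choose n) *
              (\<Prod>i<n. (if i = 0 then 1 else 0) * real n * real MR
                        + 2 * s2 * exp (Digamma ((real MR - real i) / 2))))))
           \<le> Chat MR MT rho s2 g h)"
proof (cases "MT = 0")
  case False
  then have c: "rho / real MT > 0" using assms by simp
  define f where "f \<phi> = Re (det (1\<^sub>m MR + complex_of_real (rho / real MT) \<cdot>\<^sub>m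
     (Hhat MR MT g h \<phi> * herm (Hhat MR MT g h \<phi>))))" for \<phi>
  have C: "Chat MR MT rho s2 g h = (\<integral>\<^sup>+\<phi>. ennreal (log 2 (f \<phi>)) \<partial>gaussP (mat_ix MR MT) s2)"
    by (simp add: Chat_def cap_integrand_def Phi_dist_def f_def)
  have wide: "gmean_ge (gaussP (mat_ix MR MT) s2) f
      (1 + (\<Sum>n=1..MR. (rho / real MT) ^ n * real (MR choose n) * minor_gmean s2 t n MT))"
    if "MR \<le> MT" "0 < t" "2 * t < 1" for t
    unfolding f_def using gmean_capacity[OF assms(2) that(2,3) c that(1) assms(3,4)] .
  \<comment> \<open>Transposing the channel exchanges \<open>g\<close> with \<open>h\<close> and
    \<open>MR\<close> with \<open>MT\<close>, while the factor \<open>rho / real MT\<close> stays as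
    it is; this is why \<open>gmean_capacity\<close> allows an arbitrary positive
    \<open>c\<close>.\<close>
  have tall: "gmean_ge (gaussP (mat_ix MR MT) s2) f
      (1 + (\<Sum>n=1..MT. (rho / real MT) ^ n * real (MT choose n) * minor_gmean s2 t n MR))"
    if le: "MT \<le> MR" and t: "0 < t" "2 * t < 1" for t
  proof -
    have inj: "inj_on prod.swap (mat_ix MT MR)" "prod.swap \<in> mat_ix MT MR \<rightarrow> mat_ix MR MT"
      by auto
    let ?T = "\<lambda>\<omega>. \<lambda>p\<in>mat_ix MT MR. \<omega> (prod.swap p)"
    have "Hhat MT MR h g (?T \<phi>) = transpose_mat (Hhat MR MT g h \<phi>)" for \<phi>
      by (rule eq_matI) (auto simp: Hhat_def)
    then have eq: "f \<phi> = Re (det (1\<^sub>m MT + complex_of_real (rho / real MT) \<cdot>\<^sub>m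
        (Hhat MT MR h g (?T \<phi>) * herm (Hhat MT MR h g (?T \<phi>)))))" for \<phi>
      unfolding f_def by (subst det_capacity_transpose[of _ MR MT]) (auto simp: Hhat_def)
    show ?thesis
      by (rule gmean_ge_cong[OF eq[symmetric]
            gmean_ge_distr[OF gaussP_reindex[OF assms(2) inj] gmean_capacity[OF assms(2) t c le assms(4,3)]]])
  qed
  show ?thesis
    unfolding C by (intro conjI impI nn_integral_log_lower_bound assms(2) c wide tall) auto
\<comment> \<open>For \<open>MT = 0\<close> the sum is empty in both cases, since
  \<open>MR \<le> MT\<close> forces \<open>MR = 0\<close>, and the left-hand side is 0.\<close>
qed auto

end
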